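(* Let $\kappa$ be an uncountable cardinal such that $\kappa^{<\kappa}=\kappa$. Then the embeddability quasi-order $\sqsubseteq^\kappa_{\mathsf{GRAPHS}}$ on the standard Borel $\kappa$-space $X^\kappa_{\mathsf{GRAPHS}}$ of graphs of size $\kappa$ Borel reduces to the embeddability quasi-order $\sqsubseteq^\kappa_{\mathsf{TFA}}$ on the standard Borel $\kappa$-space $X^\kappa_{\mathsf{TFA}}$ of torsion-free abelian groups of size $\kappa$. That is, there is a $\kappa^+$-Borel map $f\colon X^\kappa_{\mathsf{GRAPHS}}\to X^\kappa_{\mathsf{TFA}}$ such that for all $T,V\in X^\kappa_{\mathsf{GRAPHS}}$, $T\sqsubseteq^\kappa_{\mathsf{GRAPHS}} V$ if and only if $f(T)\sqsubseteq^\kappa_{\mathsf{TFA}} f(V)$.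
   Context: The generalized Baire space ${}^\kappa\kappa$ is the set of functions $\kappa\to\kappa$ with the bounded topology, generated by the sets $N_s=\{x\in{}^\kappa\kappa : s\subseteq x\}$ for $s\in{}^{<\kappa}\kappa$ (functions from some ordinal $<\kappa$ to $\kappa$). If $A$ has size $\kappa$, ${}^A\kappa$ (and ${}^A 2$) gets the bounded topology copied via a bijection $\kappa\to A$. A subset of a topological space is $\kappa^+$-Borel if it belongs to the smallest $\kappa^+$-algebra (closed under complements and unions of size $\le\kappa$) containing the open sets; a map is $\kappa^+$-Borel if preimages of open sets are $\kappa^+$-Borel. A $\kappa$-space is a topological space with a basis of size $\le\kappa$; it is standard Borel if it is $\kappa^+$-Borel isomorphic to a $\kappa^+$-Borel subset of ${}^\kappa\kappa$. For a language $L=\{R_i:i\in I\}$ of finitary relation symbols with $|I|<\kappa$ (functions coded as relations), $X^\kappa_L$ is the space of $L$-structures with domain $\kappa$, identified with $\prod_{i\in I}{}^{({}^{n_i}\kappa)}2$ with the product of the bounded topologies. For an $L_{\kappa^+\kappa}$-sentence $\phi$, $X^\kappa_\phi=\{\mathcal A\in X^\kappa_L:\mathcal A\models\phi\}$, a standard Borel $\kappa$-space. $X^\kappa_{\mathsf{GRAPHS}}$ is this space for (undirected, irreflexive) graphs and $X^\kappa_{\mathsf{TFA}}$ for torsion-free abelian groups. For $\mathcal A,\mathcal B\in X^\kappa_L$, $\mathcal A\sqsubseteq^\kappa_L\mathcal B$ means there is an injective $x\in{}^\kappa\kappa$ which is an isomorphism from $\mathcal A$ onto the substructure $\mathcal B\restriction\mathrm{Im}(x)$;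 $\sqsubseteq^\kappa_{\mathsf{GRAPHS}}$, $\sqsubseteq^\kappa_{\mathsf{TFA}}$ denote these relations on the respective spaces. *)

theory Defs
  imports "HOL-Analysis.Analysis" "HOL-Algebra.Group"
begin

unbundle cardinal_syntax

text \<open>
  Throughout, the cardinal \<open>\<kappa>\<close> is given by a cardinal well-order \<open>r\<close> on the whole of a type
  \<open>'k\<close> (\<open>card_order r\<close>), whose elements are the ordinals below \<open>\<kappa>\<close>; the ordinal
  \<open>a < \<kappa>\<close>, as a set of smaller ordinals, is \<open>underS r a\<close>.
\<close>

subsection \<open>Bounded topologies\<close>

text \<open>
  \<open>bounded_seqs r B\<close> is \<open>\<^sup><\<^sup>\<kappa>B\<close>: a sequence of length \<open>a < \<kappa>\<close> is a partial function with
  domain \<open>underS r a\<close>.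
\<close>

definition bounded_seqs :: "'k rel \<Rightarrow> 'b set \<Rightarrow> ('k \<rightharpoonup> 'b) set" where
  "bounded_seqs r B = {s. (\<exists>a. dom s = underS r a) \<and> ran s \<subseteq> B}"

text \<open>
  The bounded topology on the functions from \<open>A\<close> to \<open>B\<close>, copied along \<open>h : \<kappa> \<rightarrow> A\<close>. The basic
  open set given by \<open>s\<close> consists of the \<open>x\<close> with \<open>s \<subseteq> x \<circ> h\<close>. As usual in
  \<^theory>\<open>HOL-Analysis.Function_Topology\<close>, functions on \<open>A\<close> are extensional.
\<close>

definition bounded_topology_via ::
    "'k rel \<Rightarrow> ('k \<Rightarrow> 'a) \<Rightarrow> 'a set \<Rightarrow> 'b set \<Rightarrow> ('a \<Rightarrow> 'b) topology" where
  "bounded_topology_via r h A B =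
     topology_generated_by
       ((\<lambda>s. {x \<in> A \<rightarrow>\<^sub>E B. s \<subseteq>\<^sub>m (\<lambda>a. Some (x (h a)))}) ` bounded_seqs r B)"

text \<open>
  For \<open>A\<close> of size \<open>\<kappa>\<close>; if \<open>\<kappa>\<close> is regular, in particular if \<open>\<kappa>\<^sup><\<^sup>\<kappa> = \<kappa>\<close>, the topology does not
  depend on the choice of the bijection.
\<close>

definition bounded_topology :: "'k rel \<Rightarrow> 'a set \<Rightarrow> 'b set \<Rightarrow> ('a \<Rightarrow> 'b) topology" where
  "bounded_topology r A B = bounded_topology_via r (SOME h. bij_betw h UNIV A) A B"

subsection \<open>Borel sets and Borel reductions\<close>

inductive_set kplus_borel :: "'k rel \<Rightarrow> 'x topology \<Rightarrow> 'x set set"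
  for r :: "'k rel" and X :: "'x topology" where
  open_set: "openin X U \<Longrightarrow> U \<in> kplus_borel r X"
| complement: "S \<in> kplus_borel r X \<Longrightarrow> topspace X - S \<in> kplus_borel r X"
| union: "|F| \<le>o r \<Longrightarrow> (\<And>S. S \<in> F \<Longrightarrow> S \<in> kplus_borel r X) \<Longrightarrow> \<Union>F \<in> kplus_borel r X"

definition kplus_borel_map :: "'k rel \<Rightarrow> 'x topology \<Rightarrow> 'y topology \<Rightarrow> ('x \<Rightarrow> 'y) \<Rightarrow> bool" where
  "kplus_borel_map r X Y f \<longleftrightarrow>
     f \<in> topspace X \<rightarrow> topspace Y \<and>
     (\<forall>U. openin Y U \<longrightarrow> {x \<in> topspace X. f x \<in> U} \<in> kplus_borel r X)"

definition borel_reduces ::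
    "'k rel \<Rightarrow> 'x topology \<Rightarrow> ('x \<Rightarrow> 'x \<Rightarrow> bool) \<Rightarrow> 'y topology \<Rightarrow> ('y \<Rightarrow> 'y \<Rightarrow> bool) \<Rightarrow> bool" where
  "borel_reduces r X P Y Q \<longleftrightarrow>
     (\<exists>f. kplus_borel_map r X Y f \<and>
          (\<forall>x \<in> topspace X. \<forall>y \<in> topspace X. P x y \<longleftrightarrow> Q (f x) (f y)))"

subsection \<open>Spaces of structures and embeddability\<close>

text \<open>
  A relational language is given by the arities \<open>ar :: 's \<Rightarrow> nat\<close> of its symbols, all positive; a
  structure interprets each symbol as a predicate on tuples, which are lists of length \<open>ar R\<close>.
\<close>

type_synonym ('s, 'k) struct = "'s \<Rightarrow> 'k list \<Rightarrow> bool"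

definition tuples :: "'k set \<Rightarrow> nat \<Rightarrow> 'k list set" where
  "tuples D n = {t. set t \<subseteq> D \<and> length t = n}"

definition struct_space :: "'k rel \<Rightarrow> ('s \<Rightarrow> nat) \<Rightarrow> ('s, 'k) struct topology" where
  "struct_space r ar =
     product_topology (\<lambda>R. bounded_topology r (tuples UNIV (ar R)) (UNIV :: bool set)) UNIV"

definition substruct :: "('s \<Rightarrow> nat) \<Rightarrow> ('s, 'k) struct \<Rightarrow> 'k set \<Rightarrow> ('s, 'k) struct" where
  "substruct ar \<B> E = (\<lambda>R. restrict (\<B> R) (tuples E (ar R)))"

definition struct_iso ::
    "('s \<Rightarrow> nat) \<Rightarrow> 'k set \<Rightarrow> ('s, 'k) struct \<Rightarrow> 'k set \<Rightarrow> ('s, 'k) struct \<Rightarrow> ('k \<Rightarrow> 'k) \<Rightarrow> bool" where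
  "struct_iso ar D \<A> E \<B> x \<longleftrightarrow>
     bij_betw x D E \<and> (\<forall>R. \<forall>t \<in> tuples D (ar R). \<A> R t \<longleftrightarrow> \<B> R (map x t))"

definition embeddable :: "('s \<Rightarrow> nat) \<Rightarrow> ('s, 'k) struct \<Rightarrow> ('s, 'k) struct \<Rightarrow> bool" where
  "embeddable ar \<A> \<B> \<longleftrightarrow>
     (\<exists>x. inj x \<and> struct_iso ar UNIV \<A> (range x) (substruct ar \<B> (range x)) x)"

subsection \<open>Graphs and torsion-free abelian groups\<close>

datatype graph_symbol = Edge

definition graph_arity :: "graph_symbol \<Rightarrow> nat" where
  "graph_arity R = 2"

definition is_graph :: "(graph_symbol, 'k) struct \<Rightarrow> bool" where
  "is_graph \<A> \<longleftrightarrow>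
     (\<forall>a. \<not> \<A> Edge [a, a]) \<and> (\<forall>a b. \<A> Edge [a, b] \<longrightarrow> \<A> Edge [b, a])"

definition graph_space :: "'k rel \<Rightarrow> (graph_symbol, 'k) struct topology" where
  "graph_space r = subtopology (struct_space r graph_arity) {\<A>. is_graph \<A>}"

text \<open>Groups are structures for one ternary relation symbol, the graph of the group operation.\<close>

datatype group_symbol = Plus

definition group_arity :: "group_symbol \<Rightarrow> nat" where
  "group_arity R = 3"

definition torsion_free :: "('a, 'b) monoid_scheme \<Rightarrow> bool" where
  "torsion_free G \<longleftrightarrow>
     (\<forall>x \<in> carrier G. \<forall>n::nat. n > 0 \<longrightarrow> x [^]\<^bsub>G\<^esub> n = \<one>\<^bsub>G\<^esub> \<longrightarrow> x = \<one>\<^bsub>G\<^esub>)"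

definition is_tfa :: "(group_symbol, 'k) struct \<Rightarrow> bool" where
  "is_tfa \<A> \<longleftrightarrow>
     (\<exists>G :: 'k monoid. comm_group G \<and> torsion_free G \<and> carrier G = UNIV \<and>
        (\<forall>a b c. \<A> Plus [a, b, c] \<longleftrightarrow> a \<otimes>\<^bsub>G\<^esub> b = c))"

definition tfa_space :: "'k rel \<Rightarrow> (group_symbol, 'k) struct topology" where
  "tfa_space r = subtopology (struct_space r group_arity) {\<A>. is_tfa \<A>}"

end

theory Submission
  imports Defs "HOL-Algebra.Free_Abelian_Groups"
begin

text \<open>
  To a graph \<open>T\<close> on \<open>\<kappa>\<close> we attach a group of finitely supported rational measures on
  \<open>\<^sup>\<omega>\<kappa>\<close>. Divisibility by powers of distinct primes encodes, for every finite \<open>u \<subseteq> \<omega>\<close>, that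
  two sequences agree on \<open>u\<close>, and for all \<open>i, j\<close> the quantifier-free type of
  the pair \<open>(s i, s j)\<close>. A group embedding thus sends the unit mass at \<open>s\<close> to a measure whose
  restriction to \<open>u\<close> depends only on \<open>s\<restriction>u\<close>, and whose support consists of sequences with the same
  pair types as \<open>s\<close>. The size of the support of the restriction grows with \<open>u\<close>, but it is bounded
  along every countable chain, so it is constant above some finite condition. There, a point of the
  support has unique extensions, and these define a graph embedding. Conversely, a graph embedding
  pushes measures forward.

  The group is transported to \<open>\<kappa>\<close> by an explicit Cantor--Bernstein bijection. Each value of the
  resulting operation depends on countably many edges of \<open>T\<close>, so regularity of \<open>\<kappa>\<close> makes the map
  from graphs to groups continuous.
\<close>

subsection \<open>Measures and infinitely divisible elements\<close>

definition local_int :: "nat \<Rightarrow> rat \<Rightarrow> bool" where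
  "local_int p x \<longleftrightarrow> (\<exists>a b::int. \<not> int p dvd b \<and> x = of_int a / of_int b)"

lemma local_int_of_int: "prime p \<Longrightarrow> local_int p (of_int a)"
  unfolding local_int_def by (rule exI[of _ a], rule exI[of _ 1]) (auto simp: prime_nat_iff)

lemma local_int_add:
  assumes "prime p" "local_int p x" "local_int p y"
  shows "local_int p (x + y)"
proof -
  obtain a b c d :: int where *: "\<not> int p dvd b" "x = of_int a / of_int b"
    "\<not> int p dvd d" "y = of_int c / of_int d"
    using assms(2,3) unfolding local_int_def by blast
  have "b \<noteq> 0" "d \<noteq> 0" using * by auto
  then have "x + y = of_int (a * d + c * b) / of_int (b * d)"
    using * by (simp add: field_simps)
  moreover have "\<not> int p dvd b * d"
    using * assms(1) by (simp add: prime_dvd_mult_iff)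
  ultimately show ?thesis unfolding local_int_def by blast
qed

lemma local_int_uminus: "local_int p x \<Longrightarrow> local_int p (- x)"
  unfolding local_int_def by (metis minus_divide_left of_int_minus)

lemma local_int_divide_power:
  assumes "prime p" "prime q" "p \<noteq> q"
  shows "local_int p (of_int a / of_nat q ^ m)"
proof -
  have "\<not> int p dvd int q ^ m"
  proof
    assume "int p dvd int q ^ m"
    then have "p dvd q ^ m" by (simp flip: of_nat_power)
    then have "p dvd q" using assms(1) prime_dvd_power by blast
    then show False using assms primes_dvd_imp_eq by blast
  qed
  then show ?thesis
    unfolding local_int_def by (intro exI[of _ a] exI[of _ "int q ^ m"]) simp
qed

text \<open>The numerator of such an \<open>x\<close> would be divisible by every power of
  \<open>p\<close>, which a nonzero integer cannot be.\<close>

lemma local_int_divisible_imp_zero: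
  assumes p: "prime p" and div: "\<And>m. local_int p (x / of_nat p ^ m)"
  shows "x = 0"
proof (rule ccontr)
  assume "x \<noteq> 0"
  obtain n d :: int where x: "x = of_int n / of_int d" "d \<noteq> 0"
    by (metis Fract_of_int_quotient Rat_cases less_irrefl)
  have n: "n \<noteq> 0" using x \<open>x \<noteq> 0\<close> by auto
  have "int p ^ m dvd n" for m
  proof -
    obtain a b :: int where ab: "\<not> int p dvd b" "x / of_nat p ^ m = of_int a / of_int b"
      using div[of m] unfolding local_int_def by blast
    have b: "b \<noteq> 0" using ab by auto
    have "rat_of_int (n * b) = of_int (a * d * int p ^ m)"
      using ab(2) x b p by (simp add: field_simps)
    then have "n * b = a * d * int p ^ m"
      by (simp only: of_int_eq_iff)
    then have "int p ^ m dvd n * b" by simp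
    moreover have "coprime (int p ^ m) b"
      using ab(1) p by (simp add: prime_imp_coprime)
    ultimately show ?thesis
      by (simp add: coprime_dvd_mult_left_iff)
  qed
  \<comment> \<open>The exponent is the absolute value of \<open>n\<close> itself, which makes the
    power exceed it.\<close>
  then have "int p ^ nat \<bar>n\<bar> \<le> \<bar>n\<bar>"
    using n dvd_imp_le_int[of n "int p ^ nat \<bar>n\<bar>"] by simp
  moreover have "\<bar>n\<bar> < 2 ^ nat \<bar>n\<bar>"
    by (metis abs_ge_zero int_nat_eq of_nat_less_two_power)
  moreover have "(2::int) ^ nat \<bar>n\<bar> \<le> int p ^ nat \<bar>n\<bar>"
    using p by (intro power_mono) (auto dest: prime_ge_2_nat)
  ultimately show False by linarith
qed

section \<open>Distinct primes for the indices of a countable type\<close>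

definition coded_prime :: "'i::countable \<Rightarrow> nat" where
  "coded_prime k = enumerate {p. prime p} (to_nat k)"

lemma prime_coded_prime: "prime (coded_prime k)"
  using enumerate_in_set[OF primes_infinite] by (auto simp: coded_prime_def)

lemma coded_prime_eq_iff: "coded_prime k = coded_prime l \<longleftrightarrow> k = l"
  unfolding coded_prime_def
  using strict_mono_enumerate[OF primes_infinite] by (auto simp: strict_mono_eq)

section \<open>Signed measures with finite support and rational values\<close>

definition mass :: "('b \<Rightarrow>\<^sub>0 rat) \<Rightarrow> 'b set \<Rightarrow> rat" where
  "mass z S = (\<Sum>t\<in>Poly_Mapping.keys z \<inter> S. Poly_Mapping.lookup z t)"

text \<open>Enlarging the support to a common finite set lets masses of several measures be added
  termwise.\<close>

lemma mass_eq_sum: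
  assumes "finite K" "Poly_Mapping.keys z \<subseteq> K"
  shows "mass z S = (\<Sum>t\<in>K \<inter> S. Poly_Mapping.lookup z t)"
  unfolding mass_def using assms
  by (intro sum.mono_neutral_left) (auto simp: in_keys_iff)

lemma mass_zero [simp]: "mass 0 S = 0"
  by (simp add: mass_def)

lemma mass_empty [simp]: "mass z {} = 0"
  by (simp add: mass_def)

lemma mass_singleton: "mass z {t} = Poly_Mapping.lookup z t"
  by (cases "t \<in> Poly_Mapping.keys z") (auto simp: mass_def in_keys_iff)

lemma mass_add: "mass (z + w) S = mass z S + mass w S"
proof -
  let ?K = "Poly_Mapping.keys z \<union> Poly_Mapping.keys w"
  have K: "finite ?K" "Poly_Mapping.keys (z + w) \<subseteq> ?K" by (simp_all add: keys_add)
  show ?thesis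
    using mass_eq_sum[OF K] mass_eq_sum[OF K(1), of z] mass_eq_sum[OF K(1), of w]
    by (simp add: lookup_add sum.distrib)
qed

lemma mass_uminus: "mass (- z) S = - mass z S"
proof -
  have "0 = mass (z + - z) S" by simp
  then show ?thesis unfolding mass_add by linarith
qed

lemma mass_diff: "mass (z - w) S = mass z S - mass w S"
  by (metis diff_conv_add_uminus mass_add mass_uminus)

lemma mass_single: "mass (Poly_Mapping.single t c) S = (if t \<in> S then c else 0)"
  by (simp add: mass_def)

definition rscale :: "rat \<Rightarrow> ('b \<Rightarrow>\<^sub>0 rat) \<Rightarrow> ('b \<Rightarrow>\<^sub>0 rat)" where
  "rscale c z = Poly_Mapping.map ((*) c) z"

lemma lookup_rscale: "Poly_Mapping.lookup (rscale c z) t = c * Poly_Mapping.lookup z t"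
  by (simp add: rscale_def Poly_Mapping.map.rep_eq when_def)

lemma mass_rscale: "mass (rscale c z) S = c * mass z S"
proof -
  have "Poly_Mapping.keys (rscale c z) \<subseteq> Poly_Mapping.keys z"
    by (auto simp: in_keys_iff lookup_rscale)
  then show ?thesis
    using mass_eq_sum[of "Poly_Mapping.keys z" "rscale c z" S]
    by (simp add: lookup_rscale mass_def sum_distrib_left)
qed

lemma rscale_rscale: "rscale a (rscale b z) = rscale (a * b) z"
  by (rule poly_mapping_eqI) (simp add: lookup_rscale)

lemma rscale_one [simp]: "rscale 1 z = z"
  by (rule poly_mapping_eqI) (simp add: lookup_rscale)

lemma rscale_Suc: "rscale (of_nat (Suc n)) z = z + rscale (of_nat n) z"
  by (rule poly_mapping_eqI) (simp add: lookup_rscale lookup_add algebra_simps)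

lemma rscale_zero [simp]: "rscale 0 z = 0"
  by (rule poly_mapping_eqI) (simp add: lookup_rscale)

text \<open>
  An element of \<open>divisibility_group C\<close> is infinitely divisible by the prime coded by \<open>k\<close> iff its
  mass on every set in \<open>C k\<close> vanishes; additive maps preserve this condition.
\<close>

definition divisibility_group :: "('i::countable \<Rightarrow> 'b set set) \<Rightarrow> ('b \<Rightarrow>\<^sub>0 rat) set" where
  "divisibility_group C = {z. \<forall>k. \<forall>S\<in>C k. local_int (coded_prime k) (mass z S)}"

lemma divisibility_group_zero: "0 \<in> divisibility_group C"
  using local_int_of_int[OF prime_coded_prime, of _ 0] by (auto simp: divisibility_group_def)

lemma divisibility_group_add:
  "z \<in> divisibility_group C \<Longrightarrow> w \<in> divisibility_group C \<Longrightarrow> z + w \<in> divisibility_group C"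
  by (auto simp: divisibility_group_def mass_add intro: local_int_add[OF prime_coded_prime])

lemma divisibility_group_uminus:
  "z \<in> divisibility_group C \<Longrightarrow> - z \<in> divisibility_group C"
  by (auto simp: divisibility_group_def mass_uminus intro: local_int_uminus)

lemma rscale_of_nat_in_divisibility_group:
  "z \<in> divisibility_group C \<Longrightarrow> rscale (of_nat n) z \<in> divisibility_group C"
  by (induction n) (simp_all only: rscale_Suc divisibility_group_add of_nat_0 rscale_zero
      divisibility_group_zero)

lemma single_in_divisibility_group: "Poly_Mapping.single t 1 \<in> divisibility_group C"
  using local_int_of_int[OF prime_coded_prime, of _ 0] local_int_of_int[OF prime_coded_prime, of _ 1]
  by (auto simp: divisibility_group_def mass_single)

text \<open>Dividing integral masses by a power of the prime coded by \<open>k\<close> can spoil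
  integrality at that prime only, and the masses tested there are zero.\<close>

lemma infinitely_divisible:
  assumes int: "\<And>S. mass z S \<in> \<int>"
    and null: "\<And>S. S \<in> C k \<Longrightarrow> mass z S = 0"
  shows "rscale (1 / of_nat (coded_prime k) ^ m) z \<in> divisibility_group C"
  unfolding divisibility_group_def
proof (intro CollectI allI ballI)
  fix l S assume S: "S \<in> C l"
  show "local_int (coded_prime l) (mass (rscale (1 / of_nat (coded_prime k) ^ m) z) S)"
  proof (cases "l = k")
    case True
    then show ?thesis
      using null S local_int_of_int[OF prime_coded_prime, of _ 0] by (simp add: mass_rscale)
  next
    case False
    obtain a where "mass z S = of_int a" using int[of S] by (auto elim: Ints_cases)
    then show ?thesis
      using local_int_divide_power[OF prime_coded_prime prime_coded_prime, of l k a m] False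
      by (simp add: mass_rscale coded_prime_eq_iff)
  qed
qed

text \<open>For every \<open>m\<close>, \<open>z\<close> is the \<open>m\<close>-th power of the
  prime times an element of the group, hence so is its image. The mass of the image on
  \<open>S\<close> is thus a local integer divisible by all powers of the prime.\<close>

lemma additive_preserves_null:
  assumes maps: "\<And>z. z \<in> divisibility_group C \<Longrightarrow> \<phi> z \<in> divisibility_group D"
    and add: "\<And>z w. z \<in> divisibility_group C \<Longrightarrow> w \<in> divisibility_group C \<Longrightarrow> \<phi> (z + w) = \<phi> z + \<phi> w"
    and int: "\<And>S. mass z S \<in> \<int>"
    and null: "\<And>S. S \<in> C k \<Longrightarrow> mass z S = 0"
    and S: "S \<in> D k"
  shows "mass (\<phi> z) S = 0"
proof (rule local_int_divisible_imp_zero[OF prime_coded_prime[of k]])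
  fix m
  let ?q = "coded_prime k ^ m"
  let ?e = "rscale (1 / of_nat ?q) z"
  have q: "?q \<noteq> 0" using prime_coded_prime[of k] by auto
  have e: "?e \<in> divisibility_group C"
    using infinitely_divisible[OF int null, of C k m] by simp
  have "\<phi> 0 = 0" using add[OF divisibility_group_zero divisibility_group_zero] by simp
  \<comment> \<open>Additivity yields compatibility with natural multiples, so \<open>z\<close> is
    recovered as a multiple of \<open>?e\<close>.\<close>
  then have "\<phi> (rscale (of_nat n) ?e) = rscale (of_nat n) (\<phi> ?e)" for n
    by (induction n)
       (simp_all only: rscale_Suc add[OF e rscale_of_nat_in_divisibility_group[OF e]] of_nat_0 rscale_zero)
  moreover have "rscale (of_nat ?q) ?e = z"
    using prime_gt_0_nat[OF prime_coded_prime[of k]] by (simp add: rscale_rscale)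
  ultimately have "\<phi> z = rscale (of_nat ?q) (\<phi> ?e)" by metis
  then have "mass (\<phi> z) S / of_nat (coded_prime k) ^ m = mass (\<phi> ?e) S"
    using q by (simp add: mass_rscale)
  moreover have "local_int (coded_prime k) (mass (\<phi> ?e) S)"
    using maps[OF e] S by (auto simp: divisibility_group_def)
  ultimately show "local_int (coded_prime k) (mass (\<phi> z) S / of_nat (coded_prime k) ^ m)" by simp
qed

section \<open>Image measures under injections\<close>

definition push :: "('b \<Rightarrow> 'c) \<Rightarrow> ('b \<Rightarrow>\<^sub>0 rat) \<Rightarrow> ('c \<Rightarrow>\<^sub>0 rat)" where
  "push P z = Abs_poly_mapping (\<lambda>t. if t \<in> range P then Poly_Mapping.lookup z (inv_into UNIV P t) else 0)"

lemma lookup_push: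
  assumes "inj P"
  shows "Poly_Mapping.lookup (push P z) t = (if t \<in> range P then Poly_Mapping.lookup z (inv_into UNIV P t) else 0)"
proof -
  have "{t. (if t \<in> range P then Poly_Mapping.lookup z (inv_into UNIV P t) else 0) \<noteq> 0} \<subseteq> P ` Poly_Mapping.keys z"
    using assms by (auto simp: in_keys_iff split: if_splits)
  then have "finite {t. (if t \<in> range P then Poly_Mapping.lookup z (inv_into UNIV P t) else 0) \<noteq> 0}"
    by (rule finite_subset) simp
  then show ?thesis unfolding push_def by simp
qed

lemma push_add: "inj P \<Longrightarrow> push P (z + w) = push P z + push P w"
  by (rule poly_mapping_eqI) (simp add: lookup_push lookup_add)

lemma inj_push:
  assumes "inj P"
  shows "inj (push P)"
proof (rule injI)
  fix z w assume "push P z = push P w"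
  then have "Poly_Mapping.lookup (push P z) (P t) = Poly_Mapping.lookup (push P w) (P t)" for t by simp
  then show "z = w"
    using assms by (intro poly_mapping_eqI) (simp add: lookup_push)
qed

lemma mass_push:
  assumes "inj P"
  shows "mass (push P z) S = mass z (P -` S)"
proof -
  have "Poly_Mapping.keys (push P z) \<subseteq> P ` Poly_Mapping.keys z"
    using assms by (auto simp: in_keys_iff lookup_push split: if_splits)
  then have "mass (push P z) S = (\<Sum>t\<in>P ` Poly_Mapping.keys z \<inter> S. Poly_Mapping.lookup (push P z) t)"
    by (intro mass_eq_sum) auto
  also have "P ` Poly_Mapping.keys z \<inter> S = P ` (Poly_Mapping.keys z \<inter> P -` S)" by auto
  also have "(\<Sum>t\<in>P ` (Poly_Mapping.keys z \<inter> P -` S). Poly_Mapping.lookup (push P z) t)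
      = (\<Sum>t\<in>Poly_Mapping.keys z \<inter> P -` S. Poly_Mapping.lookup (push P z) (P t))"
    using assms by (subst sum.reindex) (auto intro: inj_on_subset)
  also have "\<dots> = mass z (P -` S)"
    using assms by (simp add: mass_def lookup_push)
  finally show ?thesis .
qed

text \<open>Masses of the image are masses of \<open>z\<close> on preimages; an empty preimage has
  mass 0, which is a local integer.\<close>

lemma push_in_divisibility_group:
  assumes "inj P" "\<And>k S. S \<in> D k \<Longrightarrow> P -` S = {} \<or> P -` S \<in> C k"
    and "z \<in> divisibility_group C"
  shows "push P z \<in> divisibility_group D"
  unfolding divisibility_group_def
proof (intro CollectI allI ballI)
  fix k S assume "S \<in> D k"
  then show "local_int (coded_prime k) (mass (push P z) S)"
    using assms(2)[of S k] assms(1,3) local_int_of_int[OF prime_coded_prime, of k 0]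
    by (auto simp: mass_push divisibility_group_def)
qed

subsection \<open>Coherent families of measures\<close>

definition cyl :: "(nat \<Rightarrow> 'a) \<Rightarrow> nat set \<Rightarrow> (nat \<Rightarrow> 'a) set" where
  "cyl s u = {t. \<forall>n\<in>u. t n = s n}"

text \<open>The support of the image of the measure \<open>z\<close> under restriction to \<open>u\<close>.\<close>

definition shadow :: "((nat \<Rightarrow> 'a) \<Rightarrow>\<^sub>0 rat) \<Rightarrow> nat set \<Rightarrow> (nat \<Rightarrow> 'a) set" where
  "shadow z u = {c \<in> extensional u. mass z (cyl c u) \<noteq> 0}"

lemma shadow_subset: "shadow z u \<subseteq> (\<lambda>t. restrict t u) ` Poly_Mapping.keys z"
proof
  fix c assume c: "c \<in> shadow z u"
  then have "Poly_Mapping.keys z \<inter> cyl c u \<noteq> {}"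
    by (auto simp: shadow_def mass_def)
  then obtain t where t: "t \<in> Poly_Mapping.keys z" "t \<in> cyl c u" by blast
  then have "restrict t u = c"
    using c by (auto simp: shadow_def cyl_def extensional_def)
  then show "c \<in> (\<lambda>t. restrict t u) ` Poly_Mapping.keys z" using t by blast
qed

lemma finite_shadow: "finite (shadow z u)"
  by (rule finite_subset[OF shadow_subset]) simp

lemma card_shadow_le: "card (shadow z u) \<le> card (Poly_Mapping.keys z)"
  by (meson card_image_le card_mono finite_imageI finite_keys le_trans shadow_subset)

text \<open>The mass of a cylinder over \<open>u\<close> is the sum of the masses of its
  subcylinders over \<open>v\<close>, so one of these is nonzero. The reverse inclusion can fail,
  because masses may cancel.\<close>

lemma shadow_subset_restrict_shadow:
  assumes "u \<subseteq> v"
  shows "shadow z u \<subseteq> (\<lambda>c. restrict c u) ` shadow z v"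
proof
  fix c assume c: "c \<in> shadow z u"
  let ?K = "Poly_Mapping.keys z \<inter> cyl c u"
  have "mass z (cyl c u) = (\<Sum>d\<in>(\<lambda>t. restrict t v) ` ?K. \<Sum>t\<in>{t \<in> ?K. restrict t v = d}. Poly_Mapping.lookup z t)"
    unfolding mass_def by (rule sum.image_gen) simp
  also have "\<dots> = (\<Sum>d\<in>(\<lambda>t. restrict t v) ` ?K. mass z (cyl d v))"
  proof (rule sum.cong[OF refl])
    fix d assume "d \<in> (\<lambda>t. restrict t v) ` ?K"
    then have "{t \<in> ?K. restrict t v = d} = Poly_Mapping.keys z \<inter> cyl d v"
      using assms by (auto simp: cyl_def fun_eq_iff restrict_def subset_iff split: if_splits)
    then show "(\<Sum>t\<in>{t \<in> ?K. restrict t v = d}. Poly_Mapping.lookup z t) = mass z (cyl d v)"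
      by (simp add: mass_def)
  qed
  finally have "(\<Sum>d\<in>(\<lambda>t. restrict t v) ` ?K. mass z (cyl d v)) \<noteq> 0"
    using c by (simp add: shadow_def)
  then obtain t where t: "t \<in> ?K" "mass z (cyl (restrict t v) v) \<noteq> 0"
    by (metis (no_types, lifting) imageE sum.not_neutral_contains_not_neutral)
  have "restrict (restrict t v) u = c"
    using t(1) c assms by (auto simp: shadow_def cyl_def extensional_def fun_eq_iff)
  moreover have "restrict t v \<in> shadow z v"
    using t(2) by (simp add: shadow_def)
  ultimately show "c \<in> (\<lambda>c. restrict c u) ` shadow z v" by (metis imageI)
qed

text \<open>Restriction always covers the smaller shadow; equal finite cardinalities leave no room
  for extra points or collisions.\<close>

lemma shadow_restrict_bij:
  assumes uv: "u \<subseteq> v" and card: "card (shadow z v) = card (shadow z u)"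
  shows "bij_betw (\<lambda>c. restrict c u) (shadow z v) (shadow z u)"
proof -
  have le: "card ((\<lambda>c. restrict c u) ` shadow z v) \<le> card (shadow z u)"
    using card_image_le[OF finite_shadow, of "\<lambda>c. restrict c u" z v] card by simp
  have image: "shadow z u = (\<lambda>c. restrict c u) ` shadow z v"
    using shadow_subset_restrict_shadow[OF uv] le
    by (intro card_seteq) (auto simp: finite_shadow)
  then have "inj_on (\<lambda>c. restrict c u) (shadow z v)"
    using card by (intro eq_card_imp_inj_on) (auto simp: finite_shadow)
  with image show ?thesis by (simp add: bij_betw_def)
qed

lemma shadow_nonempty:
  assumes "z \<noteq> 0"
  shows "\<exists>u. finite u \<and> shadow z u \<noteq> {}"
proof -
  obtain t where t: "t \<in> Poly_Mapping.keys z" using assms by (metis all_not_in_conv keys_eq_empty)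
  \<comment> \<open>Finitely many coordinates separate \<open>t\<close> from the rest of the
    support, so its cylinder carries the point mass at \<open>t\<close> alone.\<close>
  have "\<exists>n. t' \<noteq> t \<longrightarrow> t' n \<noteq> t n" for t' by auto
  then obtain f where f: "\<And>t'. t' \<noteq> t \<Longrightarrow> t' (f t') \<noteq> t (f t')" by metis
  define u where "u = f ` Poly_Mapping.keys z"
  have "Poly_Mapping.keys z \<inter> cyl (restrict t u) u = {t}"
    using t f by (auto simp: cyl_def u_def)
  then have "restrict t u \<in> shadow z u"
    using t by (simp add: shadow_def mass_def in_keys_iff)
  then show ?thesis by (intro exI[of _ u]) (auto simp: u_def)
qed

text \<open>In the application \<open>M s\<close> is the image of the unit mass at \<open>s\<close>
  under a group embedding, and \<open>P\<close>, \<open>Q\<close> are the pair types of two graphs.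
  The assumption \<open>diagonal\<close> holds because types record equality.\<close>

locale coherent_measures =
  fixes M :: "(nat \<Rightarrow> 'a) \<Rightarrow> (nat \<Rightarrow> 'b) \<Rightarrow>\<^sub>0 rat"
    and P :: "'a \<Rightarrow> 'a \<Rightarrow> 'c" and Q :: "'b \<Rightarrow> 'b \<Rightarrow> 'c"
  assumes coherent: "finite u \<Longrightarrow> (\<And>n. n \<in> u \<Longrightarrow> s n = s' n) \<Longrightarrow>
      mass (M s) (cyl c u) = mass (M s') (cyl c u)"
    and types: "t \<in> Poly_Mapping.keys (M s) \<Longrightarrow> P (s i) (s j) = Q (t i) (t j)"
    and diagonal: "P a a = Q x y \<Longrightarrow> x = y"
begin

lemma shadow_cong: "finite u \<Longrightarrow> (\<And>n. n \<in> u \<Longrightarrow> s n = s' n) \<Longrightarrow> shadow (M s) u = shadow (M s') u"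
  using coherent[of u s s'] by (auto simp: shadow_def)

lemma shadow_types:
  assumes "c \<in> shadow (M s) u" "i \<in> u" "j \<in> u"
  shows "P (s i) (s j) = Q (c i) (c j)"
proof -
  obtain t where "t \<in> Poly_Mapping.keys (M s)" "c = restrict t u"
    using assms(1) shadow_subset by blast
  then show ?thesis using types[of t s i j] assms by simp
qed

text \<open>
  Otherwise there would be a chain of finite restrictions with growing shadows; the chain has a
  common extension \<open>s\<close>, and \<open>M s\<close> would have infinite support.
\<close>

lemma exists_stable:
  assumes "finite u0"
  obtains s u where "finite u" "u0 \<subseteq> u" "\<And>n. n \<in> u0 \<Longrightarrow> s n = s0 n"
    "\<And>s' u'. finite u' \<Longrightarrow> u \<subseteq> u' \<Longrightarrow> (\<And>n. n \<in> u \<Longrightarrow> s' n = s n) \<Longrightarrow>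
       card (shadow (M s') u') = card (shadow (M s) u)"
proof (rule ccontr)
  note stableI = that
  \<comment> \<open>Pairs \<open>(s, u)\<close> serve as finite conditions: only the values of
    \<open>s\<close> on \<open>u\<close> matter.\<close>
  define ext where "ext = (\<lambda>(s::nat \<Rightarrow> 'a, u) (s', u'). finite u' \<and> u \<subseteq> u' \<and> (\<forall>n\<in>u. s' n = s n))"
  define N where "N = (\<lambda>(s, u). card (shadow (M s) u))"
  \<comment> \<open>By coherence both shadows can be computed from the extended sequence; then the
    larger coordinate set has at least as many points.\<close>
  have mono: "N x \<le> N y" if "ext x y" "finite (snd x)" for x y
  proof -
    obtain s u s' u' where xy: "x = (s, u)" "y = (s', u')" by fastforce
    have "shadow (M s) u = shadow (M s') u"
      using that xy by (intro shadow_cong) (auto simp: ext_def)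
    then show ?thesis
      using shadow_subset_restrict_shadow[of u u' "M s'"] that xy
      by (simp add: N_def ext_def) (meson card_image_le card_mono finite_imageI finite_shadow le_trans)
  qed
  assume "\<not> thesis"
  then have grow: "\<exists>y. ext x y \<and> N x < N y" if x: "ext (s0, u0) x" for x
  proof -
    obtain s u where su: "x = (s, u)" by fastforce
    have "\<exists>s' u'. finite u' \<and> u \<subseteq> u' \<and> (\<forall>n\<in>u. s' n = s n) \<and>
        card (shadow (M s') u') \<noteq> card (shadow (M s) u)"
    proof (rule ccontr)
      assume "\<not> ?thesis"
      moreover have "finite u" "u0 \<subseteq> u" "\<And>n. n \<in> u0 \<Longrightarrow> s n = s0 n"
        using x su by (auto simp: ext_def)
      ultimately have thesis by (intro stableI[of u s]) blast+
      with \<open>\<not> thesis\<close> show False ..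
    qed
    then obtain s' u' where "ext x (s', u')" "N (s', u') \<noteq> N x"
      by (auto simp: ext_def N_def su)
    moreover have "finite (snd x)" using x su by (auto simp: ext_def)
    ultimately show ?thesis using mono[of x "(s', u')"] by (intro exI[of _ "(s', u')"]) auto
  qed
  have "ext (s0, u0) (s0, u0)" using assms by (simp add: ext_def)
  moreover have "ext (s0, u0) y" if "ext (s0, u0) x" "ext x y" for x y
    using that by (auto simp: ext_def split: prod.splits)
  ultimately obtain f where f: "\<And>k. ext (s0, u0) (f k)" "\<And>k. ext (f k) (f (Suc k)) \<and> N (f k) < N (f (Suc k))"
    using dependent_nat_choice[of "\<lambda>_ x. ext (s0, u0) x" "\<lambda>_ x y. ext x y \<and> N x < N y"] grow
    by metis
  have fin: "finite (snd (f k))" for k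
    using f(1)[of k] by (auto simp: ext_def split: prod.splits)
  have chain: "ext (f k) (f (k + m))" for k m
  proof (induction m)
    case 0
    then show ?case using fin[of k] by (auto simp: ext_def split: prod.splits)
  next
    case (Suc m)
    then show ?case using f(2)[of "k + m"] by (auto simp: ext_def subset_iff split: prod.splits)
  qed
  \<comment> \<open>The union of the chain, read off at the first stage that decides
    \<open>n\<close>. Values at coordinates never decided are arbitrary, since no shadow in the
    chain sees them.\<close>
  define s where "s n = fst (f (LEAST k. n \<in> snd (f k))) n" for n
  have s: "s n = fst (f k) n" if "n \<in> snd (f k)" for n k
  proof -
    let ?l = "LEAST k. n \<in> snd (f k)"
    have "n \<in> snd (f ?l)" "?l \<le> k"
      using that by (auto intro: LeastI Least_le)
    then show ?thesis
      using chain[of ?l "k - ?l"] by (auto simp: ext_def s_def split: prod.splits)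
  qed
  have "N (f k) \<le> card (Poly_Mapping.keys (M s))" for k
  proof -
    have "shadow (M (fst (f k))) (snd (f k)) = shadow (M s) (snd (f k))"
      using s fin by (intro shadow_cong) auto
    then show ?thesis using card_shadow_le by (simp add: N_def case_prod_beta)
  qed
  \<comment> \<open>The cardinalities increase strictly along the chain, against the uniform bound
    by the support of \<open>M s\<close>.\<close>
  moreover have "k \<le> N (f k)" for k
    by (induction k) (use f(2) in \<open>auto intro: Suc_leI le_less_trans\<close>)
  ultimately show False by (meson Suc_n_not_le_n le_trans)
qed

text \<open>Above a stable condition all restrictions between shadows are bijective, so a fixed
  point \<open>t\<close> of the shadow lifts uniquely. Setting a fresh coordinate to
  \<open>a\<close> defines the image of \<open>a\<close> as the new entry of the lift; setting two
  fresh coordinates at once compares the types of pairs.\<close>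

lemma exists_hom:
  assumes "M s0 \<noteq> 0"
  shows "\<exists>\<sigma>. \<forall>a b. P a b = Q (\<sigma> a) (\<sigma> b)"
proof -
  obtain u0 where u0: "finite u0" "shadow (M s0) u0 \<noteq> {}"
    using shadow_nonempty[OF assms] by blast
  obtain s u where u: "finite u" "u0 \<subseteq> u" and s: "\<And>n. n \<in> u0 \<Longrightarrow> s n = s0 n"
    and stable: "\<And>s' u'. finite u' \<Longrightarrow> u \<subseteq> u' \<Longrightarrow> (\<And>n. n \<in> u \<Longrightarrow> s' n = s n) \<Longrightarrow>
       card (shadow (M s') u') = card (shadow (M s) u)"
    using exists_stable[OF u0(1), of s0] by metis
  have "shadow (M s) u0 = shadow (M s0) u0"
    using s u0(1) by (intro shadow_cong) auto
  then obtain t where t: "t \<in> shadow (M s) u"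
    using u0(2) shadow_subset_restrict_shadow[OF u(2), of "M s"] by blast
  have bij: "bij_betw (\<lambda>c. restrict c v) (shadow (M s') w) (shadow (M s') v)"
    if "u \<subseteq> v" "v \<subseteq> w" "finite w" "\<And>n. n \<in> u \<Longrightarrow> s' n = s n" for s' v w
    using that stable[of v s'] stable[of w s'] finite_subset[of v w]
    by (intro shadow_restrict_bij) auto
  have lift: "\<exists>!c. c \<in> shadow (M s') w \<and> restrict c u = t"
    if "u \<subseteq> w" "finite w" "\<And>n. n \<in> u \<Longrightarrow> s' n = s n" for s' w
  proof -
    have "t \<in> shadow (M s') u"
      using t shadow_cong[OF u(1), of s' s] that(3) by simp
    moreover have "bij_betw (\<lambda>c. restrict c u) (shadow (M s') w) (shadow (M s') u)"
      using bij[of u w s'] that by blast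
    ultimately show ?thesis
      unfolding bij_betw_def inj_on_def by (metis (no_types, lifting) imageE)
  qed
  \<comment> \<open>The unique lift of \<open>t\<close> after coordinate \<open>n\<close> is set to
    \<open>a\<close>; it is meaningful for \<open>n\<close> outside \<open>u\<close>.\<close>
  define \<rho> where "\<rho> n a = (THE c. c \<in> shadow (M (s(n := a))) (insert n u) \<and> restrict c u = t)" for n a
  define \<sigma> where "\<sigma> n a = \<rho> n a n" for n a
  have \<rho>: "c = \<rho> n a" if "n \<notin> u" "c \<in> shadow (M (s(n := a))) (insert n u)" "restrict c u = t" for n a c
  proof -
    have "\<exists>!c. c \<in> shadow (M (s(n := a))) (insert n u) \<and> restrict c u = t"
      using that(1) u(1) by (intro lift) auto
    then show ?thesis
      unfolding \<rho>_def by (rule the1_equality[symmetric]) (use that in blast)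
  qed
  have pair: "P a b = Q (\<sigma> n a) (\<sigma> m b)" if nm: "n \<notin> u" "m \<notin> u" "n \<noteq> m" for n m a b
  proof -
    let ?s = "s(n := a, m := b)" and ?w = "insert n (insert m u)"
    have "\<exists>!c. c \<in> shadow (M ?s) ?w \<and> restrict c u = t"
      using nm u(1) by (intro lift) auto
    then obtain c where c: "c \<in> shadow (M ?s) ?w" "restrict c u = t" by blast
    \<comment> \<open>Projecting the lift over both coordinates gives the lifts over each one,
      because a shadow over \<open>v\<close> depends only on the values on \<open>v\<close>.\<close>
    have proj: "restrict c v \<in> shadow (M s') v"
      if "u \<subseteq> v" "v \<subseteq> ?w" "\<And>k. k \<in> v \<Longrightarrow> s' k = ?s k" for v s'
    proof -
      have "bij_betw (\<lambda>c. restrict c v) (shadow (M ?s) ?w) (shadow (M ?s) v)"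
        using nm u(1) that by (intro bij) auto
      then have "restrict c v \<in> shadow (M ?s) v"
        using c(1) by (rule bij_betw_apply)
      moreover have "shadow (M ?s) v = shadow (M s') v"
        using that u finite_subset[OF that(2)] by (intro shadow_cong) auto
      ultimately show ?thesis by simp
    qed
    have "restrict c (insert n u) = \<rho> n a"
      using nm c(2) by (intro \<rho> proj) (auto simp: Int_absorb1 subset_insertI)
    moreover have "restrict c (insert m u) = \<rho> m b"
      using nm c(2) by (intro \<rho> proj) (auto simp: Int_absorb1 subset_insertI)
    ultimately have "c n = \<sigma> n a" "c m = \<sigma> m b"
      unfolding \<sigma>_def by (metis insertI1 restrict_apply')+
    moreover have "P (?s n) (?s m) = Q (c n) (c m)"
      by (rule shadow_types[OF c(1)]) auto
    ultimately show ?thesis using nm(3) by simp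
  qed
  obtain n where n: "n \<notin> u" using u(1) ex_new_if_finite infinite_UNIV_nat by blast
  obtain m where m: "m \<notin> insert n u"
    using u(1) ex_new_if_finite[OF infinite_UNIV_nat, of "insert n u"] by blast
  \<comment> \<open>The type of \<open>(a, a)\<close> forces equality, so the maps found at two
    fresh coordinates coincide and one of them serves in both places.\<close>
  have "\<sigma> n a = \<sigma> m a" for a
    using diagonal[OF pair[of n m a a]] n m by blast
  then have "P a b = Q (\<sigma> n a) (\<sigma> n b)" for a b
    using pair[of n m a b] n m by auto
  then show ?thesis by blast
qed

end

subsection \<open>The group of a graph\<close>

text \<open>With equality included, a map that preserves types is injective, hence an embedding of
  graphs.\<close>

definition pair_type :: "(graph_symbol, 'k) struct \<Rightarrow> 'k \<Rightarrow> 'k \<Rightarrow> bool \<times> bool" where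
  "pair_type T a b = (a = b, T Edge [a, b])"

text \<open>
  The prime coded by \<open>Inl u\<close> makes the image of a measure under restriction to \<open>u\<close> an invariant;
  those coded by \<open>Inr (i, j, l)\<close> mark the sequences whose \<open>i\<close>-th and \<open>j\<close>-th entries have type \<open>l\<close>.
\<close>

definition graph_classes ::
    "(graph_symbol, 'k) struct \<Rightarrow> nat list + nat \<times> nat \<times> bool \<times> bool \<Rightarrow> (nat \<Rightarrow> 'k) set set" where
  "graph_classes T k = (case k of
       Inl u \<Rightarrow> {cyl c (set u) |c. True}
     | Inr (i, j, l) \<Rightarrow> {{t} |t. pair_type T (t i) (t j) \<noteq> l})"

definition graph_group :: "(graph_symbol, 'k) struct \<Rightarrow> ((nat \<Rightarrow> 'k) \<Rightarrow>\<^sub>0 rat) set" where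
  "graph_group T = divisibility_group (graph_classes T)"

definition unit_mass :: "(nat \<Rightarrow> 'k) \<Rightarrow> (nat \<Rightarrow> 'k) \<Rightarrow>\<^sub>0 rat" where
  "unit_mass s = Poly_Mapping.single s 1"

lemma unit_mass_in_graph_group: "unit_mass s \<in> graph_group T"
  unfolding graph_group_def unit_mass_def by (rule single_in_divisibility_group)

text \<open>Two kinds of null elements are preserved: the difference of unit masses at sequences
  agreeing on \<open>u\<close> vanishes on cylinders over \<open>u\<close>, and a unit mass vanishes
  at points of a different type. These give coherence and preservation of types.\<close>

lemma graph_hom_of_group_embedding:
  fixes T V :: "(graph_symbol, 'k) struct"
  assumes maps: "\<And>z. z \<in> graph_group T \<Longrightarrow> \<phi> z \<in> graph_group V"
    and add: "\<And>z w. z \<in> graph_group T \<Longrightarrow> w \<in> graph_group T \<Longrightarrow> \<phi> (z + w) = \<phi> z + \<phi> w"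
    and inj: "inj_on \<phi> (graph_group T)"
  shows "\<exists>\<sigma>. \<forall>a b. pair_type T a b = pair_type V (\<sigma> a) (\<sigma> b)"
proof -
  note zero = divisibility_group_zero[of "graph_classes T", folded graph_group_def]
  have null: "mass (\<phi> z) S = 0"
    if "\<And>S. mass z S \<in> \<int>" "\<And>S. S \<in> graph_classes T k \<Longrightarrow> mass z S = 0" "S \<in> graph_classes V k" for z S k
    using additive_preserves_null[of "graph_classes T" \<phi> "graph_classes V" z k S] maps add that
    unfolding graph_group_def by blast
  have int: "mass (unit_mass s) S \<in> \<int>" for s :: "nat \<Rightarrow> 'k" and S
    by (simp add: unit_mass_def mass_single)
  have \<phi>0: "\<phi> 0 = 0" using add[OF zero zero] by simp
  have diff: "\<phi> (unit_mass s - unit_mass s') = \<phi> (unit_mass s) - \<phi> (unit_mass s')" for s s'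
  proof -
    note u = unit_mass_in_graph_group
    have neg: "- unit_mass s' \<in> graph_group T"
      unfolding graph_group_def by (rule divisibility_group_uminus) (use u[unfolded graph_group_def] in blast)
    have "\<phi> (unit_mass s + - unit_mass s') = \<phi> (unit_mass s) + \<phi> (- unit_mass s')"
      by (rule add[OF u neg])
    moreover have "\<phi> (unit_mass s') + \<phi> (- unit_mass s') = 0"
      using add[OF u neg, of s'] \<phi>0 by simp
    ultimately show ?thesis
      by (metis add_eq_0_iff diff_conv_add_uminus)
  qed
  interpret coherent_measures "\<lambda>s. \<phi> (unit_mass s)" "pair_type T" "pair_type V"
  proof
    fix u :: "nat set" and s s' c :: "nat \<Rightarrow> 'k"
    assume u: "finite u" and eq: "\<And>n. n \<in> u \<Longrightarrow> s n = s' n"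
    obtain us where us: "set us = u" using u finite_list by blast
    have "mass (\<phi> (unit_mass s - unit_mass s')) (cyl c u) = 0"
    proof (rule null[where k = "Inl us"])
      show "mass (unit_mass s - unit_mass s') S \<in> \<int>" for S
        using int[of s S] int[of s' S] by (simp add: mass_diff)
      show "mass (unit_mass s - unit_mass s') S = 0" if "S \<in> graph_classes T (Inl us)" for S
        using that us eq by (auto simp: graph_classes_def mass_diff unit_mass_def mass_single cyl_def)
      show "cyl c u \<in> graph_classes V (Inl us)"
        using us by (auto simp: graph_classes_def)
    qed
    then show "mass (\<phi> (unit_mass s)) (cyl c u) = mass (\<phi> (unit_mass s')) (cyl c u)"
      by (simp add: diff mass_diff)
  next
    fix s t :: "nat \<Rightarrow> 'k" and i j
    assume t: "t \<in> Poly_Mapping.keys (\<phi> (unit_mass s))"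
    let ?k = "Inr (i, j, pair_type T (s i) (s j))"
    show "pair_type T (s i) (s j) = pair_type V (t i) (t j)"
    proof (rule ccontr)
      assume neq: "pair_type T (s i) (s j) \<noteq> pair_type V (t i) (t j)"
      have "mass (\<phi> (unit_mass s)) {t} = 0"
      proof (rule null[where k = ?k])
        show "mass (unit_mass s) S \<in> \<int>" for S by (rule int)
        show "mass (unit_mass s) S = 0" if "S \<in> graph_classes T ?k" for S
          using that by (auto simp: graph_classes_def unit_mass_def mass_single)
        show "{t} \<in> graph_classes V ?k"
          using neq by (auto simp: graph_classes_def)
      qed
      then show False using t by (simp add: mass_singleton in_keys_iff)
    qed
  next
    show "pair_type T a a = pair_type V x y \<Longrightarrow> x = y" for a x y
      by (simp add: pair_type_def)
  qed
  \<comment> \<open>Injectivity ensures a nonzero measure to start from; the sequence is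
    arbitrary.\<close>
  have "\<phi> (unit_mass undefined) \<noteq> 0"
  proof
    assume "\<phi> (unit_mass undefined) = 0"
    then have "\<phi> (unit_mass undefined) = \<phi> 0" using \<phi>0 by simp
    then have "unit_mass undefined = (0 :: (nat \<Rightarrow> 'k) \<Rightarrow>\<^sub>0 rat)"
      by (rule inj_onD[OF inj _ unit_mass_in_graph_group zero])
    then show False
      unfolding unit_mass_def by (metis insert_not_empty keys_single keys_zero zero_neq_one)
  qed
  then show ?thesis by (rule exists_hom)
qed

text \<open>Composing sequences with \<open>\<sigma>\<close> pulls a cylinder back to a cylinder
  over the same coordinates or to nothing, and a singleton to a singleton of the same types or to
  nothing. Image measures therefore stay in the group.\<close>

lemma group_embedding_of_graph_hom:
  fixes T V :: "(graph_symbol, 'k) struct"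
  assumes \<sigma>: "\<And>a b. pair_type T a b = pair_type V (\<sigma> a) (\<sigma> b)"
  shows "\<exists>\<phi>. (\<forall>z. z \<in> graph_group T \<longrightarrow> \<phi> z \<in> graph_group V) \<and>
    (\<forall>z w. \<phi> (z + w) = \<phi> z + \<phi> w) \<and> inj \<phi>"
proof -
  have "inj \<sigma>" using \<sigma> by (auto simp: pair_type_def inj_def)
  define P where "P s = \<sigma> \<circ> s" for s :: "nat \<Rightarrow> 'k"
  have P: "inj P"
    using \<open>inj \<sigma>\<close> by (simp add: P_def inj_def fun_eq_iff)
  have "P -` S = {} \<or> P -` S \<in> graph_classes T k" if S: "S \<in> graph_classes V k" for k S
  proof (cases k)
    case (Inl u)
    then obtain c where c: "S = cyl c (set u)" using S by (auto simp: graph_classes_def)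
    have "P -` S = cyl s (set u)" if s: "s \<in> P -` S" for s
      using s \<open>inj \<sigma>\<close> by (auto simp: c cyl_def P_def inj_eq) (metis injD)
    then show ?thesis using Inl by (auto simp: graph_classes_def)
  next
    case (Inr ijl)
    obtain i j l where ijl: "ijl = (i, j, l)" by (metis prod_cases3)
    then obtain t where t: "S = {t}" "pair_type V (t i) (t j) \<noteq> l"
      using S Inr by (auto simp: graph_classes_def)
    have "P -` S = {s} \<and> pair_type T (s i) (s j) \<noteq> l" if s: "s \<in> P -` S" for s
      using s t P \<sigma> by (auto simp: P_def inj_def)
    then show ?thesis using Inr ijl by (auto simp: graph_classes_def)
  qed
  then have "push P z \<in> graph_group V" if "z \<in> graph_group T" for z
    using that unfolding graph_group_def by (rule push_in_divisibility_group[OF P])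
  then show ?thesis
    using push_add[OF P] inj_push[OF P] by (intro exI[of _ "push P"]) simp
qed

text \<open>An explicit Cantor--Bernstein bijection, so that its dependence on \<open>G\<close> can be traced.\<close>

definition cb_core :: "('b \<Rightarrow> 'a) \<Rightarrow> ('a \<Rightarrow> 'b) \<Rightarrow> 'b set \<Rightarrow> 'a set" where
  "cb_core e j G = {a. \<exists>n b. b \<notin> e ` G \<and> a = ((e \<circ> j) ^^ n) b}"

definition cb_bij :: "('b \<Rightarrow> 'a) \<Rightarrow> ('a \<Rightarrow> 'b) \<Rightarrow> 'b set \<Rightarrow> 'a \<Rightarrow> 'b" where
  "cb_bij e j G a = (if a \<in> cb_core e j G then j a else inv_into UNIV e a)"

lemma bij_betw_cb_bij:
  assumes e: "inj e" and j: "inj j" "range j \<subseteq> G"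
  shows "bij_betw (cb_bij e j G) UNIV G"
proof -
  let ?C = "cb_core e j G" and ?H = "cb_bij e j G"
  have base: "a \<in> ?C" if "a \<notin> e ` G" for a
    unfolding cb_core_def using that by (auto intro!: exI[of _ 0])
  have step: "e (j a) \<in> ?C \<longleftrightarrow> a \<in> ?C" for a
  proof
    assume "a \<in> ?C"
    then obtain n b where "b \<notin> e ` G" "a = ((e \<circ> j) ^^ n) b" by (auto simp: cb_core_def)
    then show "e (j a) \<in> ?C" unfolding cb_core_def by (auto intro!: exI[of _ "Suc n"])
  next
    assume "e (j a) \<in> ?C"
    then obtain n b where nb: "b \<notin> e ` G" "e (j a) = ((e \<circ> j) ^^ n) b" by (auto simp: cb_core_def)
    moreover have "n \<noteq> 0" using nb j by (metis funpow_0 imageI rangeI subsetD)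
    ultimately obtain m where "n = Suc m" using not0_implies_Suc by blast
    then have "a = ((e \<circ> j) ^^ m) b"
      using nb(2) e j(1) by (simp add: inj_eq)
    then show "a \<in> ?C" using nb(1) unfolding cb_core_def by blast
  qed
  have inv: "inv_into UNIV e (e z) = z" for z using e by simp
  show ?thesis
  proof (rule bij_betwI')
    have cross: False if "a \<in> ?C" "b \<notin> ?C" "j a = inv_into UNIV e b" for a b
    proof -
      obtain z where "b = e z" using base \<open>b \<notin> ?C\<close> by blast
      then have "b = e (j a)" using that inv by simp
      then show False using that step by blast
    qed
    show "?H a = ?H b \<longleftrightarrow> a = b" for a b
    proof
      assume eq: "?H a = ?H b"
      show "a = b"
      proof (cases "a \<in> ?C \<longleftrightarrow> b \<in> ?C")
        case True
        show ?thesis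
        proof (cases "a \<in> ?C")
          case True
          then show ?thesis using eq \<open>a \<in> ?C \<longleftrightarrow> b \<in> ?C\<close> j(1) by (simp add: cb_bij_def inj_eq)
        next
          case False
          then obtain x y where "a = e x" "b = e y" using base \<open>a \<in> ?C \<longleftrightarrow> b \<in> ?C\<close> by blast
          then show ?thesis using eq False \<open>a \<in> ?C \<longleftrightarrow> b \<in> ?C\<close> inv by (simp add: cb_bij_def)
        qed
      next
        case False
        then show ?thesis using eq cross[of a b] cross[of b a] by (auto simp: cb_bij_def split: if_splits)
      qed
    qed simp
    show "?H a \<in> G" for a
    proof (cases "a \<in> ?C")
      case False
      then obtain z where "a = e z" "z \<in> G" using base by blast
      then show ?thesis using False inv by (simp add: cb_bij_def)
    qed (use j(2) in \<open>auto simp: cb_bij_def\<close>)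
    show "\<exists>a\<in>UNIV. z = ?H a" if z: "z \<in> G" for z
    proof (cases "e z \<in> ?C")
      case True
      then obtain n b where nb: "b \<notin> e ` G" "e z = ((e \<circ> j) ^^ n) b" by (auto simp: cb_core_def)
      \<comment> \<open>As \<open>z\<close> is in \<open>G\<close>, its code is not a starting point
        of the core, so it has a predecessor there.\<close>
      moreover have "n \<noteq> 0" using nb z by (metis funpow_0 imageI)
      ultimately obtain m where "n = Suc m" using not0_implies_Suc by blast
      then have "z = j (((e \<circ> j) ^^ m) b)"
        using nb(2) e by (simp add: inj_eq)
      then show ?thesis
        using nb(1) by (intro bexI[of _ "((e \<circ> j) ^^ m) b"]) (auto simp: cb_bij_def cb_core_def)
    next
      case False
      then show ?thesis using inv by (intro bexI[of _ "e z"]) (auto simp: cb_bij_def)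
    qed
  qed
qed

text \<open>Whether \<open>a\<close> lies in the core depends only on the \<open>(e \<circ> j)\<close>-ancestors of \<open>a\<close>.\<close>

lemma cb_bij_cong:
  assumes "\<And>n b z. ((e \<circ> j) ^^ n) b = a \<Longrightarrow> b = e z \<Longrightarrow> z \<in> G \<longleftrightarrow> z \<in> G'"
  shows "cb_bij e j G a = cb_bij e j G' a"
proof -
  have "b \<in> e ` G \<longleftrightarrow> b \<in> e ` G'" if "((e \<circ> j) ^^ n) b = a" for n b
    using assms[OF that] by blast
  then have "a \<in> cb_core e j G \<longleftrightarrow> a \<in> cb_core e j G'"
    unfolding cb_core_def by blast
  then show ?thesis by (simp add: cb_bij_def)
qed

text \<open>The cylinder conditions do not mention the graph, and the singleton conditions are
  trivial away from the support of \<open>z\<close>.\<close>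

lemma graph_group_cong:
  assumes "\<And>t i j. t \<in> Poly_Mapping.keys z \<Longrightarrow> T Edge [t i, t j] = T' Edge [t i, t j]"
  shows "z \<in> graph_group T \<longleftrightarrow> z \<in> graph_group T'"
proof -
  have "z \<in> graph_group V'" if z: "z \<in> graph_group V"
    and eq: "\<And>t i j. t \<in> Poly_Mapping.keys z \<Longrightarrow> V Edge [t i, t j] = V' Edge [t i, t j]" for V V'
    unfolding graph_group_def divisibility_group_def
  proof (intro CollectI allI ballI)
    fix k S assume S: "S \<in> graph_classes V' k"
    show "local_int (coded_prime k) (mass z S)"
    proof (cases "S \<in> graph_classes V k")
      case True
      then show ?thesis using z by (auto simp: graph_group_def divisibility_group_def)
    next
      case False
      then obtain i j l where k: "k = Inr (i, j, l)"
        using S by (cases k) (auto simp: graph_classes_def)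
      then obtain t where t: "S = {t}" "pair_type V' (t i) (t j) \<noteq> l"
        using S by (auto simp: graph_classes_def)
      then have "pair_type V (t i) (t j) = l"
        using False k by (auto simp: graph_classes_def)
      then have "t \<notin> Poly_Mapping.keys z"
        using eq t(2) by (auto simp: pair_type_def)
      with t(1) show ?thesis
        using local_int_of_int[OF prime_coded_prime, of k 0] by (simp add: mass_singleton in_keys_iff)
    qed
  qed
  then show ?thesis using assms by metis
qed

subsection \<open>Cardinality and continuity\<close>

lemma card_order_UNIV_ordIso: "card_order r \<Longrightarrow> |UNIV :: 'k set| =o (r :: 'k rel)"
  using card_of_unique ordIso_symmetric by blast

lemma infinite_UNIV_of_natLeq_ordLess:
  assumes "card_order (r :: 'k rel)" "natLeq <o r"
  shows "infinite (UNIV :: 'k set)"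
proof -
  have "|UNIV :: nat set| \<le>o |UNIV :: 'k set|"
    using assms card_order_UNIV_ordIso card_of_nat
    by (meson ordIso_ordLeq_trans ordIso_symmetric ordLeq_ordIso_trans ordLess_imp_ordLeq)
  then show ?thesis
    using card_of_ordLeq_infinite infinite_UNIV_nat by blast
qed

text \<open>The assumption \<open>bounded_seqs\<close> is the hypothesis
  \<open>\<kappa>\<^sup><\<^sup>\<kappa> = \<kappa>\<close>.\<close>

locale kappa =
  fixes r :: "'k rel"
  assumes card_order: "card_order r"
    and uncountable: "natLeq <o r"
    and bounded_seqs: "|bounded_seqs r (UNIV :: 'k set)| =o r"
begin

lemma Card_order: "Card_order r"
  using card_order by (metis card_order_on_Card_order)

lemma Field: "Field r = UNIV"
  using card_order by (metis card_order_on_Card_order)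

lemma well_order: "Well_order r"
  using Card_order card_order_on_well_order_on by blast

lemma UNIV_ordIso: "|UNIV :: 'k set| =o r"
  using card_order by (rule card_order_UNIV_ordIso)

lemma infinite_UNIV: "infinite (UNIV :: 'k set)"
  using card_order uncountable by (rule infinite_UNIV_of_natLeq_ordLess)

lemma countable_ordLess:
  assumes "countable A"
  shows "|A| <o r"
proof -
  obtain f :: "'a \<Rightarrow> nat" where "inj_on f A" using assms by (rule countableE)
  then have "|A| \<le>o |UNIV :: nat set|" by (intro card_of_ordLeqI[of f]) auto
  then show ?thesis
    using uncountable card_of_nat by (meson ordIso_ordLess_trans ordLeq_ordLess_trans)
qed

text \<open>A small set is in bijection with a proper initial segment of \<kappa>, so functions on
  it become bounded sequences, of which there are only \<kappa> many.\<close>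

lemma small_functions_inject:
  assumes "|A| <o r"
  shows "\<exists>F :: ('a \<Rightarrow> 'k) \<Rightarrow> 'k. \<forall>f g. F f = F g \<longrightarrow> (\<forall>x\<in>A. f x = g x)"
proof -
  obtain a where "|A| =o Restr r (underS r a)"
    using assms ordLess_iff_ordIso_Restr[OF well_order card_of_Well_order] by blast
  then have "|A| =o |Field (Restr r (underS r a))|"
    using card_of_cong by fastforce
  then obtain h where h: "bij_betw h A (Field (Restr r (underS r a)))"
    using card_of_ordIso by blast
  then have hA: "inj_on h A" "h ` A \<subseteq> underS r a"
    by (auto simp: bij_betw_def Field_def)
  define s where "s f = (\<lambda>x. if x \<in> underS r a then Some (f (inv_into A h x)) else None)" for f :: "'a \<Rightarrow> 'k"
  have "s f \<in> bounded_seqs r UNIV" for f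
    by (auto simp: bounded_seqs_def s_def dom_def intro!: exI[of _ a])
  moreover have "|bounded_seqs r (UNIV :: 'k set)| =o |UNIV :: 'k set|"
    using bounded_seqs ordIso_symmetric[OF UNIV_ordIso] by (rule ordIso_transitive)
  then obtain c where "bij_betw c (bounded_seqs r (UNIV :: 'k set)) (UNIV :: 'k set)"
    using card_of_ordIso by blast
  then have "inj_on c (bounded_seqs r UNIV)" by (simp add: bij_betw_def)
  ultimately have s_inj: "s f = s g" if "c (s f) = c (s g)" for f g
    using that by (simp add: inj_on_eq_iff)
  have "f x = g x" if "c (s f) = c (s g)" "x \<in> A" for f g x
  proof -
    have "s f (h x) = s g (h x)" using s_inj[OF that(1)] by simp
    then show ?thesis using hA that(2) by (auto simp: s_def image_subset_iff)
  qed
  then show ?thesis by (intro exI[of _ "c \<circ> s"]) auto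
qed

text \<open>
  Koenig's diagonal argument: an unbounded small set would make the functions on it more
  numerous than \<open>\<kappa>\<close>.
\<close>

lemma small_imp_bounded:
  assumes E: "|E :: 'k set| <o r"
  shows "\<exists>b. E \<subseteq> underS r b"
proof (rule ccontr)
  assume unbounded: "\<nexists>b. E \<subseteq> underS r b"
  obtain F :: "('k \<Rightarrow> 'k) \<Rightarrow> 'k" where F: "\<And>f g. F f = F g \<Longrightarrow> \<forall>x\<in>E. f x = g x"
    using small_functions_inject[OF E] by metis
  \<comment> \<open>\<open>G\<close> lists along \<kappa> a representative of every function up to
    agreement on \<open>E\<close>.\<close>
  define G where "G \<xi> = (SOME f. F f = \<xi>)" for \<xi>
  have G: "F (G (F f)) = F f" for f
    unfolding G_def by (rule someI[of "\<lambda>g. F g = F f"]) (rule refl)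
  \<comment> \<open>At \<open>a\<close>, fewer than \<kappa> functions of the list must be avoided:
    those with index below \<open>a\<close>.\<close>
  have "\<exists>y. y \<notin> (\<lambda>\<xi>. G \<xi> a) ` underS r a" for a
  proof -
    have "|(\<lambda>\<xi>. G \<xi> a) ` underS r a| <o r"
      using card_of_underS[OF Card_order, of a] Field card_of_image ordLeq_ordLess_trans by blast
    then have "(\<lambda>\<xi>. G \<xi> a) ` underS r a \<noteq> UNIV"
      using UNIV_ordIso not_ordLess_ordIso by metis
    then show ?thesis by blast
  qed
  then obtain g where g: "\<And>a. g a \<notin> (\<lambda>\<xi>. G \<xi> a) ` underS r a" by metis
  \<comment> \<open>Some \<open>a\<close> in \<open>E\<close> is not below \<open>b\<close>, hence
    lies strictly above the index of \<open>g\<close>; there \<open>g\<close> avoids its own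
    representative.\<close>
  obtain b where b: "F g \<noteq> b" "(F g, b) \<in> r"
    using infinite_Card_order_limit[OF Card_order, of "F g"] infinite_UNIV Field by auto
  obtain a where a: "a \<in> E" "a \<notin> underS r b" using unbounded by blast
  have "(b, a) \<in> r"
  proof -
    have "refl r" "total r" using well_order Field by (auto simp: order_on_defs)
    then show ?thesis
      using a(2) total_on_def[of UNIV r]
      by (cases "a = b") (auto simp: underS_def dest: refl_onD)
  qed
  with b have "(F g, a) \<in> r" "F g \<noteq> a"
    using well_order by (auto simp: order_on_defs trans_def antisym_def)
  then have "F g \<in> underS r a" by (simp add: underS_def)
  moreover have "G (F g) a = g a" using F[OF G] a(1) by blast
  ultimately show False using g[of a] by (metis imageI)
qed

text \<open>Enumerating each \<open>D a\<close> covers the union by an image of the product of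
  \<open>A\<close> with the naturals, a product of two small sets.\<close>

lemma UNION_countable_ordLess:
  assumes "|A| <o r" "\<And>a. a \<in> A \<Longrightarrow> countable (D a)"
  shows "|\<Union>a\<in>A. D a| <o r"
proof -
  have "(\<Union>a\<in>A. D a) \<subseteq> (\<lambda>(a, n). from_nat_into (D a) n) ` (A \<times> UNIV)"
  proof
    fix x assume "x \<in> (\<Union>a\<in>A. D a)"
    then obtain a where a: "a \<in> A" "x \<in> D a" by blast
    then show "x \<in> (\<lambda>(a, n). from_nat_into (D a) n) ` (A \<times> UNIV)"
      using from_nat_into_to_nat_on[OF assms(2)[OF a(1)] a(2)]
      by (intro image_eqI[of _ _ "(a, to_nat_on (D a) x)"]) auto
  qed
  then have "|\<Union>a\<in>A. D a| \<le>o |A \<times> (UNIV :: nat set)|"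
    by (meson card_of_image card_of_mono1 ordLeq_transitive)
  moreover have "|A \<times> (UNIV :: nat set)| <o r"
    using infinite_UNIV Field Card_order assms(1) countable_ordLess[of "UNIV :: nat set"]
    by (intro card_of_Times_ordLess_infinite_Field) simp_all
  ultimately show ?thesis by (rule ordLeq_ordLess_trans)
qed

text \<open>Countable sequences are coded in \<kappa>, so a measure becomes a finite set of coded
  pairs of a point and its value; \<kappa> has only \<kappa> finite subsets.\<close>

lemma exists_inj_measures: "\<exists>e :: ((nat \<Rightarrow> 'k) \<Rightarrow>\<^sub>0 rat) \<Rightarrow> 'k. inj e"
proof -
  obtain F :: "(nat \<Rightarrow> 'k) \<Rightarrow> 'k" where F: "\<And>f g. F f = F g \<Longrightarrow> \<forall>x\<in>UNIV. f x = g x"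
    using small_functions_inject[OF countable_ordLess, of "UNIV :: nat set"] by auto
  have "|UNIV :: rat set| \<le>o |UNIV :: 'k set|"
    using countable_ordLess[of "UNIV :: rat set"] UNIV_ordIso
    by (meson countableI_type ordIso_symmetric ordLess_imp_ordLeq ordLess_ordIso_trans)
  then obtain q :: "rat \<Rightarrow> 'k" where q: "inj q"
    by (auto simp flip: card_of_ordLeq)
  have "|(UNIV :: 'k set) \<times> (UNIV :: 'k set)| \<le>o |UNIV :: 'k set|"
    using card_of_Times_same_infinite[OF infinite_UNIV] ordIso_imp_ordLeq by blast
  then obtain p :: "'k \<times> 'k \<Rightarrow> 'k" where p: "inj p"
    by (auto simp flip: card_of_ordLeq)
  obtain c where c: "inj_on c (Fpow (UNIV :: 'k set))" and "c ` Fpow (UNIV :: 'k set) \<subseteq> (UNIV :: 'k set)"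
    using card_of_Fpow_infinite[OF infinite_UNIV] ordIso_imp_ordLeq
    by (meson card_of_ordLeq)
  define S where "S z = (\<lambda>t. p (F t, q (Poly_Mapping.lookup z t))) ` Poly_Mapping.keys z"
    for z :: "(nat \<Rightarrow> 'k) \<Rightarrow>\<^sub>0 rat"
  have "Poly_Mapping.lookup z t = Poly_Mapping.lookup w t" if "S z = S w" "t \<in> Poly_Mapping.keys z" for z w t
  proof -
    obtain t' where "p (F t, q (Poly_Mapping.lookup z t)) = p (F t', q (Poly_Mapping.lookup w t'))"
      using \<open>S z = S w\<close> \<open>t \<in> Poly_Mapping.keys z\<close> unfolding S_def by blast
    then have "F t = F t'" "Poly_Mapping.lookup z t = Poly_Mapping.lookup w t'"
      using p q by (auto simp: inj_eq)
    moreover have "t = t'" using F[OF \<open>F t = F t'\<close>] by auto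
    ultimately show ?thesis by simp
  qed
  then have "z = w" if "S z = S w" for z w
    using that by (intro poly_mapping_eqI) (metis in_keys_iff)
  moreover have "S z \<in> Fpow UNIV" for z by (simp add: S_def Fpow_def)
  ultimately have "inj (c \<circ> S)"
    using c by (auto simp: inj_def inj_on_def)
  then show ?thesis by blast
qed

section \<open>Open sets given by agreement on a small set of tuples\<close>

lemma bij_tuples:
  assumes "n > 0"
  shows "bij_betw (SOME h. bij_betw h (UNIV :: 'k set) (tuples (UNIV :: 'k set) n)) UNIV (tuples (UNIV :: 'k set) n)"
proof -
  have "|tuples (UNIV :: 'k set) n| \<le>o |lists (UNIV :: 'k set)|"
    by (rule card_of_mono1) auto
  then have "|tuples (UNIV :: 'k set) n| \<le>o |UNIV :: 'k set|"
    using card_of_lists_infinite[OF infinite_UNIV] by (rule ordLeq_ordIso_trans)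
  moreover have "|UNIV :: 'k set| \<le>o |tuples (UNIV :: 'k set) n|"
    using assms by (intro card_of_ordLeqI[of "replicate n"]) (auto simp: inj_on_def tuples_def)
  ultimately have "|UNIV :: 'k set| =o |tuples (UNIV :: 'k set) n|"
    by (simp add: ordIso_iff_ordLeq)
  then have "\<exists>h. bij_betw h (UNIV :: 'k set) (tuples (UNIV :: 'k set) n)"
    by (simp flip: card_of_ordIso)
  then show ?thesis by (rule someI_ex)
qed

text \<open>The indices of fewer than \<kappa> tuples are bounded in \<kappa>, so fixing an initial
  segment of \<open>x\<close> fixes its values on \<open>D\<close>.\<close>

lemma openin_bounded_topology_agree:
  assumes n: "n > 0" and D: "|D| <o r" "D \<subseteq> tuples UNIV n"
  shows "openin (bounded_topology r (tuples (UNIV :: 'k set) n) (UNIV :: 'b set))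
    {x \<in> tuples UNIV n \<rightarrow>\<^sub>E UNIV. \<forall>t\<in>D. x t = x0 t}" (is "openin ?X ?U")
proof (subst openin_subopen, intro ballI)
  fix x assume x: "x \<in> ?U"
  define h where "h = (SOME h. bij_betw h (UNIV :: 'k set) (tuples (UNIV :: 'k set) n))"
  have h: "bij_betw h UNIV (tuples UNIV n)" unfolding h_def using n by (rule bij_tuples)
  have "|h -` D| <o r"
  proof -
    have "|h -` D| \<le>o |D|"
      using h by (intro card_of_ordLeqI[of h]) (auto simp: bij_betw_def inj_on_def)
    then show ?thesis using D(1) by (rule ordLeq_ordLess_trans)
  qed
  then obtain b where b: "h -` D \<subseteq> underS r b" using small_imp_bounded by blast
  define s where "s = (\<lambda>a. if a \<in> underS r b then Some (x (h a)) else None)"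
  let ?N = "{y \<in> tuples UNIV n \<rightarrow>\<^sub>E UNIV. s \<subseteq>\<^sub>m (\<lambda>a. Some (y (h a)))}"
  have "s \<in> bounded_seqs r UNIV"
    by (auto simp: bounded_seqs_def s_def dom_def intro!: exI[of _ b])
  then have "openin ?X ?N"
    unfolding bounded_topology_def bounded_topology_via_def h_def
    by (intro topology_generated_by_Basis imageI)
  moreover have "x \<in> ?N"
    using x by (auto simp: s_def map_le_def dom_def)
  moreover have agree: "y t = x0 t" if y: "y \<in> ?N" and t: "t \<in> D" for y t
  proof -
    obtain a where a: "t = h a" using h D(2) t by (auto simp: bij_betw_def)
    then have "a \<in> underS r b" using b t by auto
    then have "s a = Some (x (h a))" by (simp add: s_def)
    moreover from this have "s a = Some (y (h a))"
      using y unfolding map_le_def by (simp only: mem_Collect_eq) (metis domI)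
    ultimately have "y t = x t" using a by simp
    then show ?thesis using x t by simp
  qed
  moreover have "?N \<subseteq> ?U"
  proof
    fix y assume y: "y \<in> ?N"
    then show "y \<in> ?U" using agree[OF y] by simp
  qed
  ultimately show "\<exists>N. openin ?X N \<and> x \<in> N \<and> N \<subseteq> ?U" by (intro exI[of _ ?N] conjI)
qed

lemma openin_graph_space_agree:
  assumes "|D| <o r" "D \<subseteq> tuples UNIV 2"
  shows "openin (graph_space r) {T \<in> topspace (graph_space r). \<forall>t\<in>D. T Edge t = T0 Edge t}"
proof -
  let ?B = "bounded_topology r (tuples UNIV (graph_arity Edge)) UNIV"
  let ?U = "{x \<in> tuples UNIV 2 \<rightarrow>\<^sub>E UNIV. \<forall>t\<in>D. x t = T0 Edge t}"
  have cont: "continuous_map (graph_space r) ?B (\<lambda>T. T Edge)"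
    unfolding graph_space_def struct_space_def
    by (intro continuous_map_from_subtopology continuous_map_product_projection) simp
  have "openin ?B ?U"
    using openin_bounded_topology_agree[OF _ assms] by (simp add: graph_arity_def)
  then have "openin (graph_space r) {T \<in> topspace (graph_space r). T Edge \<in> ?U}"
    by (rule openin_continuous_map_preimage[OF cont])
  moreover have "T Edge \<in> tuples UNIV 2 \<rightarrow>\<^sub>E UNIV" if "T \<in> topspace (graph_space r)" for T
  proof -
    have "T Edge \<in> topspace ?B"
      using continuous_map_image_subset_topspace[OF cont] that by blast
    then show ?thesis
      by (auto simp: bounded_topology_def bounded_topology_via_def topology_generated_by_topspace
          graph_arity_def)
  qed
  then have "{T \<in> topspace (graph_space r). T Edge \<in> ?U} =
      {T \<in> topspace (graph_space r). \<forall>t\<in>D. T Edge t = T0 Edge t}" by blast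
  ultimately show ?thesis by simp
qed

end

section \<open>Transport of the group to \<kappa>\<close>

definition coding :: "(((nat \<Rightarrow> 'k) \<Rightarrow>\<^sub>0 rat) \<Rightarrow> 'k) \<Rightarrow> (graph_symbol, 'k) struct \<Rightarrow> 'k \<Rightarrow> (nat \<Rightarrow> 'k) \<Rightarrow>\<^sub>0 rat" where
  "coding e T = cb_bij e (\<lambda>a. unit_mass (\<lambda>_. a)) (graph_group T)"

text \<open>The restriction to triples makes the interpretation extensional, as the points of the
  function space have to be.\<close>

definition group_struct :: "(((nat \<Rightarrow> 'k) \<Rightarrow>\<^sub>0 rat) \<Rightarrow> 'k) \<Rightarrow> (graph_symbol, 'k) struct \<Rightarrow> (group_symbol, 'k) struct" where
  "group_struct e T R = restrict
     (\<lambda>t. coding e T (t ! 0) + coding e T (t ! 1) = coding e T (t ! 2)) (tuples UNIV 3)"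

lemma inj_unit_mass_const: "inj (\<lambda>a. unit_mass (\<lambda>_. a))"
proof (rule injI)
  fix a b :: 'a
  assume "unit_mass (\<lambda>_. a) = unit_mass (\<lambda>_. b)"
  then have "{\<lambda>_::nat. a} = {\<lambda>_. b}"
    unfolding unit_mass_def by (metis keys_single zero_neq_one)
  then show "a = b" by (metis singleton_inject)
qed

lemma bij_betw_coding:
  assumes "inj e"
  shows "bij_betw (coding e T) UNIV (graph_group T)"
  unfolding coding_def
proof (rule bij_betw_cb_bij[OF assms])
qed (use inj_unit_mass_const unit_mass_in_graph_group in auto)

lemma group_struct_Plus:
  "group_struct e T Plus [a, b, c] \<longleftrightarrow> coding e T a + coding e T b = coding e T c"
  by (simp add: group_struct_def tuples_def)

text \<open>Images of tuples lie in the range of the embedding, so passing to the substructure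
  changes no value.\<close>

lemma embeddable_graph_iff:
  "embeddable graph_arity T V \<longleftrightarrow> (\<exists>\<sigma>. \<forall>a b. pair_type T a b = pair_type V (\<sigma> a) (\<sigma> b))"
proof
  assume "embeddable graph_arity T V"
  then obtain x where x: "inj x" "\<And>R t. t \<in> tuples UNIV (graph_arity R) \<Longrightarrow>
      T R t = substruct graph_arity V (range x) R (map x t)"
    by (auto simp: embeddable_def struct_iso_def)
  have "T Edge [a, b] = V Edge [x a, x b]" for a b
    using x(2)[of "[a, b]" Edge] by (simp add: tuples_def graph_arity_def substruct_def)
  then show "\<exists>\<sigma>. \<forall>a b. pair_type T a b = pair_type V (\<sigma> a) (\<sigma> b)"
    using x(1) by (auto simp: pair_type_def inj_eq intro!: exI[of _ x])
next
  assume "\<exists>\<sigma>. \<forall>a b. pair_type T a b = pair_type V (\<sigma> a) (\<sigma> b)"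
  then obtain \<sigma> where \<sigma>: "\<And>a b. (a = b) = (\<sigma> a = \<sigma> b)" "\<And>a b. T Edge [a, b] = V Edge [\<sigma> a, \<sigma> b]"
    by (auto simp: pair_type_def)
  have "inj \<sigma>" using \<sigma>(1) by (auto simp: inj_def)
  moreover have "T R t = substruct graph_arity V (range \<sigma>) R (map \<sigma> t)"
    if "t \<in> tuples UNIV (graph_arity R)" for R t
  proof -
    have "R = Edge" by (cases R)
    moreover have "length t = Suc (Suc 0)" using that by (simp add: tuples_def graph_arity_def)
    then obtain a b where "t = [a, b]" by (metis length_0_conv length_Suc_conv)
    ultimately show ?thesis
      using \<sigma>(2) by (simp add: tuples_def graph_arity_def substruct_def)
  qed
  ultimately show "embeddable graph_arity T V"
    by (auto simp: embeddable_def struct_iso_def inj_on_imp_bij_betw)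
qed

lemma embeddable_group_iff:
  "embeddable group_arity A B \<longleftrightarrow>
    (\<exists>x. inj x \<and> (\<forall>a b c. A Plus [a, b, c] = B Plus [x a, x b, x c]))"
proof
  assume "embeddable group_arity A B"
  then obtain x where x: "inj x" "\<And>R t. t \<in> tuples UNIV (group_arity R) \<Longrightarrow>
      A R t = substruct group_arity B (range x) R (map x t)"
    by (auto simp: embeddable_def struct_iso_def)
  have "A Plus [a, b, c] = B Plus [x a, x b, x c]" for a b c
    using x(2)[of "[a, b, c]" Plus] by (simp add: tuples_def group_arity_def substruct_def)
  then show "\<exists>x. inj x \<and> (\<forall>a b c. A Plus [a, b, c] = B Plus [x a, x b, x c])"
    using x(1) by blast
next
  assume "\<exists>x. inj x \<and> (\<forall>a b c. A Plus [a, b, c] = B Plus [x a, x b, x c])"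
  then obtain x where x: "inj x" "\<And>a b c. A Plus [a, b, c] = B Plus [x a, x b, x c]" by blast
  have "A R t = substruct group_arity B (range x) R (map x t)"
    if "t \<in> tuples UNIV (group_arity R)" for R t
  proof -
    have "R = Plus" by (cases R)
    moreover have "length t = Suc (Suc (Suc 0))" using that by (simp add: tuples_def group_arity_def)
    then obtain a b c where "t = [a, b, c]" by (metis length_0_conv length_Suc_conv)
    ultimately show ?thesis
      using x(2) by (simp add: tuples_def group_arity_def substruct_def)
  qed
  then show "embeddable group_arity A B"
    using x(1) by (auto simp: embeddable_def struct_iso_def inj_on_imp_bij_betw)
qed

lemma graph_group_add: "z \<in> graph_group T \<Longrightarrow> w \<in> graph_group T \<Longrightarrow> z + w \<in> graph_group T"
  unfolding graph_group_def by (rule divisibility_group_add)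

text \<open>Conjugation by the codings turns embeddings of the structures into injective additive
  maps between the groups, and back.\<close>

lemma embeddable_group_struct_iff:
  assumes e: "inj e"
  shows "embeddable group_arity (group_struct e T) (group_struct e V) \<longleftrightarrow> embeddable graph_arity T V"
proof
  let ?S = "coding e T" and ?H = "coding e V"
  note S = bij_betw_coding[OF e, of T] and H = bij_betw_coding[OF e, of V]
  define S' where "S' = inv_into UNIV ?S"
  have S': "?S (S' z) = z" if "z \<in> graph_group T" for z
    using S that by (simp add: S'_def bij_betw_inv_into_right)
  {
    assume "embeddable group_arity (group_struct e T) (group_struct e V)"
    then obtain x where x: "inj x"
      "\<And>a b c. ?S a + ?S b = ?S c \<longleftrightarrow> ?H (x a) + ?H (x b) = ?H (x c)"
      by (auto simp: embeddable_group_iff group_struct_Plus)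
    define \<phi> where "\<phi> z = ?H (x (S' z))" for z
    have "\<phi> z \<in> graph_group V" for z
      using H by (auto simp: \<phi>_def bij_betw_def)
    moreover have "\<phi> (z + w) = \<phi> z + \<phi> w" if "z \<in> graph_group T" "w \<in> graph_group T" for z w
      using x(2)[of "S' z" "S' w" "S' (z + w)"] S' that graph_group_add[OF that]
      by (simp add: \<phi>_def)
    moreover have "inj_on \<phi> (graph_group T)"
    proof (rule inj_onI)
      fix z w assume zw: "z \<in> graph_group T" "w \<in> graph_group T" and "\<phi> z = \<phi> w"
      then have "S' z = S' w"
        using H x(1) by (auto simp: \<phi>_def bij_betw_def inj_eq)
      then show "z = w" using S' zw by metis
    qed
    ultimately show "embeddable graph_arity T V"
      unfolding embeddable_graph_iff by (intro graph_hom_of_group_embedding) auto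
  }
  {
    assume "embeddable graph_arity T V"
    then obtain \<sigma> where "\<And>a b. pair_type T a b = pair_type V (\<sigma> a) (\<sigma> b)"
      by (auto simp: embeddable_graph_iff)
    then obtain \<phi> where \<phi>: "\<And>z. z \<in> graph_group T \<Longrightarrow> \<phi> z \<in> graph_group V"
        "\<And>z w. \<phi> (z + w) = \<phi> z + \<phi> w" "inj \<phi>"
      using group_embedding_of_graph_hom[of T V \<sigma>] by blast
    define x where "x a = inv_into UNIV ?H (\<phi> (?S a))" for a
    have Sa: "?S a \<in> graph_group T" for a using S by (auto simp: bij_betw_def)
    have Hx: "?H (x a) = \<phi> (?S a)" for a
      using H \<phi>(1)[OF Sa] by (simp add: x_def bij_betw_inv_into_right)
    have "inj x"
    proof (rule injI)
      fix a b assume "x a = x b"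
      then have "\<phi> (?S a) = \<phi> (?S b)" using Hx by metis
      then show "a = b" using \<phi>(3) S by (auto simp: inj_eq bij_betw_def)
    qed
    \<comment> \<open>Additivity gives one direction; the other cancels the injective
      \<open>\<phi>\<close>.\<close>
    moreover have "?S a + ?S b = ?S c \<longleftrightarrow> ?H (x a) + ?H (x b) = ?H (x c)" for a b c
      using \<phi>(2,3) by (metis Hx injD)
    ultimately show "embeddable group_arity (group_struct e T) (group_struct e V)"
      by (auto simp: embeddable_group_iff group_struct_Plus)
  }
qed

text \<open>The operation is transported from an additive group of rational measures, where a
  nonzero measure has no vanishing positive multiple.\<close>

lemma is_tfa_group_struct:
  fixes e :: "((nat \<Rightarrow> 'k) \<Rightarrow>\<^sub>0 rat) \<Rightarrow> 'k"
  assumes e: "inj e"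
  shows "is_tfa (group_struct e T)"
proof -
  let ?S = "coding e T"
  note S = bij_betw_coding[OF e, of T]
  define S' where "S' = inv_into UNIV ?S"
  have S': "?S (S' z) = z" if "z \<in> graph_group T" for z
    using S that by (simp add: S'_def bij_betw_inv_into_right)
  have inS: "?S a \<in> graph_group T" for a using S by (auto simp: bij_betw_def)
  have injS: "?S a = ?S b \<longleftrightarrow> a = b" for a b using S by (auto simp: bij_betw_def inj_eq)
  have zero: "0 \<in> graph_group T" unfolding graph_group_def by (rule divisibility_group_zero)
  have uminus: "- z \<in> graph_group T" if "z \<in> graph_group T" for z
    using that unfolding graph_group_def by (rule divisibility_group_uminus)
  define G :: "'k monoid" where
    "G = \<lparr>carrier = UNIV, mult = (\<lambda>a b. S' (?S a + ?S b)), one = S' 0\<rparr>"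
  have mult: "?S (a \<otimes>\<^bsub>G\<^esub> b) = ?S a + ?S b" for a b
    by (simp add: G_def S' graph_group_add inS)
  have one: "?S \<one>\<^bsub>G\<^esub> = 0" by (simp add: G_def S' zero)
  have carrier: "carrier G = UNIV" by (simp add: G_def)
  have eqI: "a = b" if "?S a = ?S b" for a b using that injS by simp
  have "comm_group G"
  proof (rule comm_groupI)
    show "\<exists>b\<in>carrier G. b \<otimes>\<^bsub>G\<^esub> a = \<one>\<^bsub>G\<^esub>" for a
      by (intro bexI[of _ "S' (- ?S a)"] eqI) (simp_all add: mult one S' uminus inS carrier)
  qed (auto simp: carrier intro!: eqI simp: mult one add_ac)
  moreover have "torsion_free G"
    unfolding torsion_free_def
  proof (intro ballI allI impI)
    fix a and n :: nat assume n: "n > 0" "a [^]\<^bsub>G\<^esub> n = \<one>\<^bsub>G\<^esub>"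
    have "?S (a [^]\<^bsub>G\<^esub> k) = rscale (of_nat k) (?S a)" for k :: nat
      by (induction k) (simp_all only: nat_pow_def nat.rec old.nat.simps one mult rscale_Suc of_nat_0 rscale_zero
          add.commute)
    with n(2) have "rscale (of_nat n) (?S a) = 0" using one by metis
    then have "?S a = 0"
      using n(1) by (metis (no_types, lifting) lookup_rscale lookup_zero mult_eq_0_iff not_less_zero
          of_nat_eq_0_iff poly_mapping_eqI)
    then show "a = \<one>\<^bsub>G\<^esub>" by (intro eqI) (simp add: one)
  qed
  moreover have "group_struct e T Plus [a, b, c] \<longleftrightarrow> a \<otimes>\<^bsub>G\<^esub> b = c" for a b c
    by (metis group_struct_Plus injS mult)
  ultimately show ?thesis
    unfolding is_tfa_def using carrier by blast
qed

text \<open>The vertex pairs on which \<open>coding e T a\<close> can depend: \<open>z\<close> runs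
  over the measures whose code is an ancestor of \<open>a\<close>, and the pairs over entries of
  points in its support.\<close>

definition coding_support :: "(((nat \<Rightarrow> 'k) \<Rightarrow>\<^sub>0 rat) \<Rightarrow> 'k) \<Rightarrow> 'k \<Rightarrow> 'k list set" where
  "coding_support e a = (\<Union>n. \<Union>z\<in>{z. ((e \<circ> (\<lambda>a. unit_mass (\<lambda>_. a))) ^^ n) (e z) = a}.
     \<Union>t\<in>Poly_Mapping.keys z. \<Union>i. \<Union>j. {[t i, t j]})"

text \<open>By injectivity each \<open>n\<close> admits at most one \<open>z\<close>, whose finitely
  many support points have countably many entries.\<close>

lemma countable_coding_support:
  assumes "inj e"
  shows "countable (coding_support e a)"
proof -
  have inj: "inj (\<lambda>z. ((e \<circ> (\<lambda>a. unit_mass (\<lambda>_. a))) ^^ n) (e z))" for n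
    using inj_compose[OF inj_fn[OF inj_compose[OF assms inj_unit_mass_const], of n] assms]
    by (simp add: comp_def)
  then have "countable {z. ((e \<circ> (\<lambda>a. unit_mass (\<lambda>_. a))) ^^ n) (e z) = a}" for n
    using finite_vimageI[OF _ inj[of n], of "{a}"] by (simp add: vimage_def countable_finite)
  then show ?thesis
    unfolding coding_support_def by (intro countable_UN) (auto intro: countable_finite)
qed

lemma coding_cong:
  assumes "\<And>t. t \<in> coding_support e a \<Longrightarrow> T Edge t = T' Edge t"
  shows "coding e T a = coding e T' a"
  unfolding coding_def
proof (rule cb_bij_cong)
  fix n b z
  assume z: "((e \<circ> (\<lambda>a. unit_mass (\<lambda>_. a))) ^^ n) b = a" "b = e z"
  have "[t i, t j] \<in> coding_support e a" if t: "t \<in> Poly_Mapping.keys z" for t i j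
    unfolding coding_support_def using z
    by (intro UN_I[of n] UN_I[of z] UN_I[OF t] UN_I[of i] UN_I[of j]) simp_all
  then show "z \<in> graph_group T \<longleftrightarrow> z \<in> graph_group T'"
    using assms by (intro graph_group_cong) simp
qed

lemma coding_support_subset: "coding_support e a \<subseteq> tuples UNIV 2"
  by (auto simp: coding_support_def tuples_def)

section \<open>Continuity of the map from graphs to groups\<close>

context kappa
begin

text \<open>A basic open set fixes fewer than \<kappa> values of the operation. Each involves three
  codings with countable support, so fewer than \<kappa> vertex pairs decide membership.\<close>

lemma continuous_map_group_struct:
  fixes e :: "((nat \<Rightarrow> 'k) \<Rightarrow>\<^sub>0 rat) \<Rightarrow> 'k"
  assumes e: "inj e"
  shows "continuous_map (graph_space r) (tfa_space r) (group_struct e)"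
proof -
  let ?A = "tuples (UNIV :: 'k set) 3"
  define h where "h = (SOME h. bij_betw h (UNIV :: 'k set) ?A)"
  have h: "bij_betw h UNIV ?A" unfolding h_def by (rule bij_tuples) simp
  have ext: "group_struct e T R \<in> ?A \<rightarrow>\<^sub>E UNIV" for T R
    by (auto simp: group_struct_def)
  have "continuous_map (graph_space r) (bounded_topology r ?A UNIV) (\<lambda>T. group_struct e T R)" for R
    unfolding bounded_topology_def bounded_topology_via_def h_def[symmetric] continuous_on_generated_topo_iff
  proof (intro conjI allI impI)
    fix U
    assume "U \<in> (\<lambda>s. {x \<in> ?A \<rightarrow>\<^sub>E (UNIV :: bool set). s \<subseteq>\<^sub>m (\<lambda>a. Some (x (h a)))}) ` bounded_seqs r UNIV"
    then obtain s a0 where U: "U = {x \<in> ?A \<rightarrow>\<^sub>E UNIV. s \<subseteq>\<^sub>m (\<lambda>a. Some (x (h a)))}"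
      and s: "dom s = underS r a0"
      by (auto simp: bounded_seqs_def)
    define D where "D = (\<Union>a\<in>underS r a0. \<Union>i\<in>{0,1,2}. coding_support e (h a ! i))"
    have "|D| <o r"
      unfolding D_def using countable_coding_support[OF e] card_of_underS[OF Card_order, of a0] Field
      by (intro UNION_countable_ordLess countable_UN) auto
    moreover have "D \<subseteq> tuples UNIV 2"
      unfolding D_def by (intro UN_least coding_support_subset)
    ultimately have D: "openin (graph_space r) {T \<in> topspace (graph_space r). \<forall>t\<in>D. T Edge t = T0 Edge t}" for T0
      by (rule openin_graph_space_agree)
    have cong: "group_struct e T R (h a) = group_struct e T0 R (h a)"
      if "\<forall>t\<in>D. T Edge t = T0 Edge t" "a \<in> underS r a0" for T T0 a
    proof -
      have "coding e T (h a ! i) = coding e T0 (h a ! i)" if "i \<in> {0,1,2}" for i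
        using \<open>\<forall>t\<in>D. T Edge t = T0 Edge t\<close> \<open>a \<in> underS r a0\<close> that
        by (intro coding_cong) (auto simp: D_def)
      then show ?thesis by (simp add: group_struct_def restrict_def)
    qed
    show "openin (graph_space r) ((\<lambda>T. group_struct e T R) -` U \<inter> topspace (graph_space r))"
    \<comment> \<open>Every graph in the preimage has a neighbourhood there: the graphs that agree
      with it on \<open>D\<close>.\<close>
    proof (subst openin_subopen, intro ballI)
      fix T0 assume T0: "T0 \<in> (\<lambda>T. group_struct e T R) -` U \<inter> topspace (graph_space r)"
      let ?N = "{T \<in> topspace (graph_space r). \<forall>t\<in>D. T Edge t = T0 Edge t}"
      have "group_struct e T R \<in> U" if "T \<in> ?N" for T
        using T0 cong[of T T0] that ext[of T R] s by (auto simp: U map_le_def)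
      then show "\<exists>N. openin (graph_space r) N \<and> T0 \<in> N \<and>
          N \<subseteq> (\<lambda>T. group_struct e T R) -` U \<inter> topspace (graph_space r)"
        using D[of T0] T0 by (intro exI[of _ ?N]) auto
    qed
  next
    show "(\<lambda>T. group_struct e T R) ` topspace (graph_space r) \<subseteq>
      \<Union>((\<lambda>s. {x \<in> ?A \<rightarrow>\<^sub>E UNIV. s \<subseteq>\<^sub>m (\<lambda>a. Some (x (h a)))}) ` bounded_seqs r UNIV)"
    proof
      fix x assume "x \<in> (\<lambda>T. group_struct e T R) ` topspace (graph_space r)"
      then have x: "x \<in> ?A \<rightarrow>\<^sub>E UNIV" using ext by blast
      \<comment> \<open>Any bounded restriction of \<open>x\<close> shows that the basic sets cover
        the space; its length is arbitrary.\<close>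
      define s where "s = (\<lambda>a. if a \<in> underS r undefined then Some (x (h a)) else None)"
      have "s \<in> bounded_seqs r UNIV"
        by (auto simp: bounded_seqs_def s_def dom_def intro!: exI[of _ undefined])
      moreover have "s \<subseteq>\<^sub>m (\<lambda>a. Some (x (h a)))"
        by (auto simp: s_def map_le_def dom_def)
      ultimately show "x \<in> \<Union>((\<lambda>s. {x \<in> ?A \<rightarrow>\<^sub>E UNIV. s \<subseteq>\<^sub>m (\<lambda>a. Some (x (h a)))}) ` bounded_seqs r UNIV)"
        using x by blast
    qed
  qed
  then have "continuous_map (graph_space r) (struct_space r group_arity) (group_struct e)"
    unfolding struct_space_def continuous_map_componentwise_UNIV group_arity_def by blast
  then show ?thesis
    unfolding tfa_space_def continuous_map_in_subtopology
    using is_tfa_group_struct[OF e] by auto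
qed

end

lemma continuous_imp_kplus_borel_map: "continuous_map X Y f \<Longrightarrow> kplus_borel_map r X Y f"
  unfolding kplus_borel_map_def continuous_map by (auto intro: kplus_borel.open_set)

theorem theorem1p2:
  fixes r :: "'k rel"
  assumes "card_order r"
    and "natLeq <o r"
    and "|bounded_seqs r (UNIV :: 'k set)| =o r"
  shows "borel_reduces r
           (graph_space r) (embeddable graph_arity)
           (tfa_space r) (embeddable group_arity)"
proof -
  interpret kappa r using assms by unfold_locales
  \<comment> \<open>The injection is chosen once for all graphs, so that the reduction is a single
    map.\<close>
  obtain e :: "((nat \<Rightarrow> 'k) \<Rightarrow>\<^sub>0 rat) \<Rightarrow> 'k" where e: "inj e"
    using exists_inj_measures by blast
  show ?thesis
    unfolding borel_reduces_def
    using continuous_imp_kplus_borel_map[OF continuous_map_group_struct[OF e]]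
      embeddable_group_struct_iff[OF e] by blast
qed

end
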